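(* Let $\Bbbk$ be an algebraically closed field and let $A$ be a basic finite-dimensional $\Bbbk$-algebra, quasi-hereditary with respect to the natural order on $\{1,\dots,n\}$. Let $\Delta=\bigoplus_{i=1}^n\Delta(i)$ and $\nabla=\bigoplus_{i=1}^n\nabla(i)$ be the direct sums of all standard and of all costandard modules, let $$0\to T_k\xrightarrow{\varphi_k}\cdots\xrightarrow{\varphi_2}T_1\xrightarrow{\varphi_1}T_0\xrightarrow{\varphi_0}\nabla\to0$$ be a minimal tilting resolution of $\nabla$, with associated complex of tilting modules $\mathcal T(\nabla)^\bullet$ ($T_l$ in position $-l$), and let $l\in\{0,\dots,k\}$. Let $f\in\operatorname{Hom}_A(\Delta,T_l)$ and let $g\in\operatorname{Hom}_{Com}(\mathcal T(\nabla)^\bullet,\nabla^\bullet[l])$ be a morphism of complexes. If $g$ is homotopic to zero, then $\langle f,g\rangle^{(l)}=0$. In particular, $\langle\cdot\,,\cdot\rangle^{(l)}$ induces a bilinear map $$\operatorname{Hom}_A(\Delta,T_l)\times\operatorname{Ext}^l_A(\nabla,\nabla)\to\Bbbk .$$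
   Context: $\nabla^\bullet$ denotes the complex with $\nabla$ in position $0$ and zero elsewhere, so $\nabla^\bullet[l]$ is concentrated in position $-l$, and $\operatorname{Hom}_{Com}(\mathcal T(\nabla)^\bullet,\nabla^\bullet[l])\subset\operatorname{Hom}_A(T_l,\nabla)$ consists of those $g$ with $g\circ\varphi_{l+1}=0$. A tilting module is a module having both a filtration by standard modules and a filtration by costandard modules; a tilting resolution is an exact sequence as displayed with all $T_l$ tilting, and minimality means that no two neighbouring terms have a common non-zero direct summand on which the differential induces an isomorphism. For each $i$ fix a non-zero $\alpha_i:\Delta(i)\to\nabla(i)$; then $\operatorname{Hom}_A(\Delta,\nabla)=\bigoplus_{i=1}^n\Bbbk\alpha_i$. For $f\in\operatorname{Hom}_A(\Delta,T_l)$ and $g\in\operatorname{Hom}_A(T_l,\nabla)$ write $g\circ f=\sum_{i=1}^na_i\alpha_i$ with $a_i\in\Bbbk$. The bilinear map $\langle\cdot\,,\cdot\rangle^{(l)}:\operatorname{Hom}_A(\Delta,T_l)\times\operatorname{Hom}_{Com}(\mathcal T(\nabla)^\bullet,\nabla^\bullet[l])\to\Bbbk$ is defined by $\langle f,g\rangle^{(l)}=\sum_{i=1}^na_i$. The space $\operatorname{Ext}^l_A(\nabla,\nabla)$ is identified with the space of homotopy classes of morphisms of complexes $\mathcal T(\nabla)^\bullet\to\nabla^\bullet[l]$. *)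

theory Defs
  imports "HOL-Computational_Algebra.Polynomial" "HOL-Library.Function_Algebras"
begin

locale fd_algebra = vector_space scale
  for scale :: "'k::alg_closed_field \<Rightarrow> 'a::ring_1 \<Rightarrow> 'a" +
  assumes scale_mult_left: "scale c a * b = scale c (a * b)"
    and scale_mult_right: "a * scale c b = scale c (a * b)"
    and finite_dim: "\<exists>B. finite B \<and> span B = UNIV"

text \<open>
  A left module is a carrier inside an ambient abelian group, whose addition it inherits,
  together with an action of the algebra that only matters on the carrier.
\<close>

record ('a, 'm) lmod =
  car :: "'m set"
  act :: "'a \<Rightarrow> 'm \<Rightarrow> 'm"

definition lmodule :: "('a::ring_1, 'm::ab_group_add) lmod \<Rightarrow> bool" where
  "lmodule M \<longleftrightarrow>
     0 \<in> car M \<and>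
     (\<forall>x\<in>car M. \<forall>y\<in>car M. x + y \<in> car M) \<and>
     (\<forall>x\<in>car M. - x \<in> car M) \<and>
     (\<forall>a. \<forall>x\<in>car M. act M a x \<in> car M) \<and>
     (\<forall>a. \<forall>x\<in>car M. \<forall>y\<in>car M. act M a (x + y) = act M a x + act M a y) \<and>
     (\<forall>a b. \<forall>x\<in>car M. act M (a + b) x = act M a x + act M b x) \<and>
     (\<forall>a b. \<forall>x\<in>car M. act M (a * b) x = act M a (act M b x)) \<and>
     (\<forall>x\<in>car M. act M 1 x = x)"

definition scalar ::
  "('k \<Rightarrow> 'a::ring_1 \<Rightarrow> 'a) \<Rightarrow> ('a, 'm) lmod \<Rightarrow> 'k \<Rightarrow> 'm \<Rightarrow> 'm" where
  "scalar scale M c x = act M (scale c 1) x"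

text \<open>
  Homomorphisms are extended by 0 outside the carrier of their source. Thus equality, sums and
  composites of homomorphisms are those of functions.
\<close>

definition Hom ::
  "('a, 'm::ab_group_add) lmod \<Rightarrow> ('a, 'n::ab_group_add) lmod \<Rightarrow> ('m \<Rightarrow> 'n) set" where
  "Hom M N =
     {f. (\<forall>x\<in>car M. f x \<in> car N) \<and> (\<forall>x. x \<notin> car M \<longrightarrow> f x = 0) \<and>
         (\<forall>x\<in>car M. \<forall>y\<in>car M. f (x + y) = f x + f y) \<and>
         (\<forall>a. \<forall>x\<in>car M. f (act M a x) = act N a (f x))}"

definition hom_scale ::
  "('k \<Rightarrow> 'a::ring_1 \<Rightarrow> 'a) \<Rightarrow> ('a, 'n) lmod \<Rightarrow> 'k \<Rightarrow> ('m \<Rightarrow> 'n) \<Rightarrow> 'm \<Rightarrow> 'n" where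
  "hom_scale scale N c f = (\<lambda>x. scalar scale N c (f x))"

definition isomorphic ::
  "('a, 'm::ab_group_add) lmod \<Rightarrow> ('a, 'n::ab_group_add) lmod \<Rightarrow> bool" where
  "isomorphic M N \<longleftrightarrow> (\<exists>f\<in>Hom M N. bij_betw f (car M) (car N))"

definition submodule :: "'m set \<Rightarrow> ('a::ring_1, 'm::ab_group_add) lmod \<Rightarrow> bool" where
  "submodule U M \<longleftrightarrow> U \<subseteq> car M \<and> lmodule (M\<lparr>car := U\<rparr>)"

text \<open>
  That \<open>M / U\<close> is isomorphic to \<open>X\<close>, stated through an epimorphism from \<open>M\<close> onto \<open>X\<close> with
  kernel \<open>U\<close>.
\<close>

definition quotient_iso ::
  "('a, 'm::ab_group_add) lmod \<Rightarrow> 'm set \<Rightarrow> ('a, 'n::ab_group_add) lmod \<Rightarrow> bool" where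
  "quotient_iso M U X \<longleftrightarrow>
     (\<exists>p\<in>Hom M X. p ` car M = car X \<and> {x \<in> car M. p x = 0} = U)"

definition filtered ::
  "('a::ring_1, 'x::ab_group_add) lmod set \<Rightarrow> ('a, 'm::ab_group_add) lmod \<Rightarrow> bool" where
  "filtered S M \<longleftrightarrow>
     (\<exists>r U. U 0 = {0} \<and> U r = car M \<and> (\<forall>s\<le>r. submodule (U s) M) \<and>
        (\<forall>s<r. U s \<subseteq> U (Suc s) \<and>
           (\<exists>X\<in>S. quotient_iso (M\<lparr>car := U (Suc s)\<rparr>) (U s) X)))"

text \<open>The direct sum of \<open>M 1, \<dots>, M n\<close>, realised as families supported on \<open>{1..n}\<close>.\<close>

definition dsum :: "nat \<Rightarrow> (nat \<Rightarrow> ('a, 'm::ab_group_add) lmod) \<Rightarrow> ('a, nat \<Rightarrow> 'm) lmod" where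
  "dsum n M =
     \<lparr>car = {x. (\<forall>i\<in>{1..n}. x i \<in> car (M i)) \<and> (\<forall>i. i \<notin> {1..n} \<longrightarrow> x i = 0)},
      act = (\<lambda>a x i. if i \<in> {1..n} then act (M i) a (x i) else 0)\<rparr>"

definition primitive_idempotent :: "'a::ring_1 \<Rightarrow> bool" where
  "primitive_idempotent u \<longleftrightarrow>
     u \<noteq> 0 \<and> u * u = u \<and>
     \<not> (\<exists>v w. v \<noteq> 0 \<and> w \<noteq> 0 \<and> v * v = v \<and> w * w = w \<and> v * w = 0 \<and> w * v = 0 \<and> u = v + w)"

definition Proj :: "(nat \<Rightarrow> 'a::ring_1) \<Rightarrow> nat \<Rightarrow> ('a, 'a) lmod" where
  "Proj e i = \<lparr>car = {a * e i |a. True}, act = (*)\<rparr>"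

text \<open>
  The injective module \<open>I(i) = D(e\<^sub>i A)\<close>, the dual being taken over the ground field. A linear
  functional on \<open>e\<^sub>i A\<close> is identified with its extension to \<open>A\<close> that vanishes on
  \<open>(1 - e\<^sub>i) A\<close>.
\<close>

definition Inj ::
  "('k::field \<Rightarrow> 'a::ring_1 \<Rightarrow> 'a) \<Rightarrow> (nat \<Rightarrow> 'a) \<Rightarrow> nat \<Rightarrow> ('a, 'a \<Rightarrow> 'k) lmod" where
  "Inj scale e i =
     \<lparr>car = {\<xi>. Vector_Spaces.linear scale (*) \<xi> \<and> (\<forall>x. \<xi> (e i * x) = \<xi> x)},
      act = (\<lambda>a \<xi> x. \<xi> (x * a))\<rparr>"

text \<open>
  A labelling of the indecomposable projectives (hence of the simples) of a basic algebra
  by \<open>{1..n}\<close> is a complete system of primitive orthogonal idempotents.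
\<close>

definition basic_algebra :: "nat \<Rightarrow> (nat \<Rightarrow> 'a::ring_1) \<Rightarrow> bool" where
  "basic_algebra n e \<longleftrightarrow>
     (\<forall>i\<in>{1..n}. primitive_idempotent (e i)) \<and>
     (\<forall>i\<in>{1..n}. \<forall>j\<in>{1..n}. i \<noteq> j \<longrightarrow> e i * e j = 0) \<and>
     (\<Sum>i\<in>{1..n}. e i) = 1 \<and>
     (\<forall>i\<in>{1..n}. \<forall>j\<in>{1..n}. i \<noteq> j \<longrightarrow> \<not> isomorphic (Proj e i) (Proj e j))"

text \<open>The trace of the projectives with label \<open>> i\<close> in the \<open>i\<close>-th one (a sum of images).\<close>

definition upper_trace :: "nat \<Rightarrow> (nat \<Rightarrow> 'a::ring_1) \<Rightarrow> nat \<Rightarrow> 'a set" where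
  "upper_trace n e i =
     \<Inter>{U. submodule U (Proj e i) \<and>
         (\<forall>j\<in>{i<..n}. \<forall>f\<in>Hom (Proj e j) (Proj e i). f ` car (Proj e j) \<subseteq> U)}"

definition standard_module ::
  "nat \<Rightarrow> (nat \<Rightarrow> 'a::ring_1) \<Rightarrow> nat \<Rightarrow> ('a, 'd::ab_group_add) lmod \<Rightarrow> bool" where
  "standard_module n e i D \<longleftrightarrow> lmodule D \<and> quotient_iso (Proj e i) (upper_trace n e i) D"

text \<open>
  Dually, costandard modules are the common kernels of all maps from the \<open>i\<close>-th injective to
  those with label \<open>> i\<close>.
\<close>

definition lower_kernel ::
  "('k::field \<Rightarrow> 'a::ring_1 \<Rightarrow> 'a) \<Rightarrow> nat \<Rightarrow> (nat \<Rightarrow> 'a) \<Rightarrow> nat \<Rightarrow> ('a \<Rightarrow> 'k) set" where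
  "lower_kernel scale n e i =
     {\<xi> \<in> car (Inj scale e i).
        \<forall>j\<in>{i<..n}. \<forall>f\<in>Hom (Inj scale e i) (Inj scale e j). f \<xi> = 0}"

definition costandard_module ::
  "('k::field \<Rightarrow> 'a::ring_1 \<Rightarrow> 'a) \<Rightarrow> nat \<Rightarrow> (nat \<Rightarrow> 'a) \<Rightarrow> nat \<Rightarrow>
     ('a, 'c::ab_group_add) lmod \<Rightarrow> bool" where
  "costandard_module scale n e i N \<longleftrightarrow>
     lmodule N \<and> isomorphic N ((Inj scale e i)\<lparr>car := lower_kernel scale n e i\<rparr>)"

text \<open>
  Here \<open>Delta\<close> is the family of standard modules: their endomorphism rings are the ground field,
  and the kernel of the epimorphism from each indecomposable projective onto its standard module
  is filtered by standard modules with strictly larger labels.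
\<close>

definition quasi_hereditary ::
  "('k::field \<Rightarrow> 'a::ring_1 \<Rightarrow> 'a) \<Rightarrow> nat \<Rightarrow> (nat \<Rightarrow> 'a) \<Rightarrow>
     (nat \<Rightarrow> ('a, 'd::ab_group_add) lmod) \<Rightarrow> bool" where
  "quasi_hereditary scale n e Delta \<longleftrightarrow>
     (\<forall>i\<in>{1..n}. car (Delta i) \<noteq> {0} \<and>
        (\<forall>f\<in>Hom (Delta i) (Delta i). \<exists>c. \<forall>x\<in>car (Delta i). f x = scalar scale (Delta i) c x) \<and>
        filtered (Delta ` {i<..n}) ((Proj e i)\<lparr>car := upper_trace n e i\<rparr>))"

definition tilting ::
  "nat \<Rightarrow> (nat \<Rightarrow> ('a::ring_1, 'd::ab_group_add) lmod) \<Rightarrow>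
     (nat \<Rightarrow> ('a, 'c::ab_group_add) lmod) \<Rightarrow> ('a, 't::ab_group_add) lmod \<Rightarrow> bool" where
  "tilting n Delta Nabla T \<longleftrightarrow>
     lmodule T \<and> filtered (Delta ` {1..n}) T \<and> filtered (Nabla ` {1..n}) T"

text \<open>
  Exactness of \<open>0 \<rightarrow> T k \<rightarrow> \<dots> \<rightarrow> T 0 \<rightarrow> M \<rightarrow> 0\<close>, where \<open>\<phi> l\<close> maps \<open>T l\<close> to \<open>T (l - 1)\<close> for
  \<open>1 \<le> l \<le> k\<close> and \<open>\<epsilon>\<close> (the map usually called \<open>\<phi> 0\<close>) maps \<open>T 0\<close> to \<open>M\<close>.
\<close>

definition tilting_resolution ::
  "nat \<Rightarrow> (nat \<Rightarrow> ('a::ring_1, 'd::ab_group_add) lmod) \<Rightarrow>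
     (nat \<Rightarrow> ('a, 'c::ab_group_add) lmod) \<Rightarrow> ('a, 'm::ab_group_add) lmod \<Rightarrow> nat \<Rightarrow>
     (nat \<Rightarrow> ('a, 't::ab_group_add) lmod) \<Rightarrow> (nat \<Rightarrow> 't \<Rightarrow> 't) \<Rightarrow> ('t \<Rightarrow> 'm) \<Rightarrow> bool" where
  "tilting_resolution n Delta Nabla M k T \<phi> \<epsilon> \<longleftrightarrow>
     (\<forall>l\<le>k. tilting n Delta Nabla (T l)) \<and>
     \<epsilon> \<in> Hom (T 0) M \<and> (\<forall>l\<in>{1..k}. \<phi> l \<in> Hom (T l) (T (l - 1))) \<and>
     \<epsilon> ` car (T 0) = car M \<and>
     (\<forall>l\<le>k. {x \<in> car (T l). (if l = 0 then \<epsilon> x = 0 else \<phi> l x = 0)} =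
              (if l = k then {0} else \<phi> (Suc l) ` car (T (Suc l))))"

definition decomposes ::
  "('a::ring_1, 'm::ab_group_add) lmod \<Rightarrow> 'm set \<Rightarrow> 'm set \<Rightarrow> bool" where
  "decomposes M X X' \<longleftrightarrow>
     submodule X M \<and> submodule X' M \<and> X \<inter> X' = {0} \<and> (\<forall>m\<in>car M. \<exists>x\<in>X. \<exists>x'\<in>X'. m = x + x')"

definition projection :: "'m::ab_group_add set \<Rightarrow> 'm set \<Rightarrow> 'm \<Rightarrow> 'm" where
  "projection Y Y' m = (THE y. y \<in> Y \<and> m - y \<in> Y')"

text \<open>
  Minimality concerns the complex of tilting modules only: the augmentation \<open>\<epsilon>\<close> may well
  be an isomorphism on a common summand of \<open>T 0\<close> and the resolved module.
\<close>

definition minimal_complex ::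
  "nat \<Rightarrow> (nat \<Rightarrow> ('a::ring_1, 't::ab_group_add) lmod) \<Rightarrow> (nat \<Rightarrow> 't \<Rightarrow> 't) \<Rightarrow> bool" where
  "minimal_complex k T \<phi> \<longleftrightarrow>
     (\<forall>l\<in>{1..k}. \<not> (\<exists>X X' Y Y'. decomposes (T l) X X' \<and> decomposes (T (l - 1)) Y Y' \<and>
        X \<noteq> {0} \<and> bij_betw (\<lambda>x. projection Y Y' (\<phi> l x)) X Y))"

text \<open>Cochain complexes: \<open>bdry C m\<close> maps \<open>obj C m\<close> to \<open>obj C (m + 1)\<close>.\<close>

record ('a, 'm) cpx =
  obj :: "int \<Rightarrow> ('a, 'm) lmod"
  bdry :: "int \<Rightarrow> 'm \<Rightarrow> 'm"

definition zero_lmod :: "('a, 'm::zero) lmod" where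
  "zero_lmod = \<lparr>car = {0}, act = (\<lambda>_ _. 0)\<rparr>"

definition stalk :: "('a, 'm::ab_group_add) lmod \<Rightarrow> ('a, 'm) cpx" where
  "stalk M = \<lparr>obj = (\<lambda>m. if m = 0 then M else zero_lmod), bdry = (\<lambda>_ _. 0)\<rparr>"

definition shift :: "('a, 'm::ab_group_add) cpx \<Rightarrow> int \<Rightarrow> ('a, 'm) cpx" where
  "shift C p = \<lparr>obj = (\<lambda>m. obj C (m + p)),
                bdry = (\<lambda>m x. if even p then bdry C (m + p) x else - bdry C (m + p) x)\<rparr>"

definition tilting_complex ::
  "nat \<Rightarrow> (nat \<Rightarrow> ('a, 't::ab_group_add) lmod) \<Rightarrow> (nat \<Rightarrow> 't \<Rightarrow> 't) \<Rightarrow> ('a, 't) cpx" where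
  "tilting_complex k T \<phi> =
     \<lparr>obj = (\<lambda>m. if - int k \<le> m \<and> m \<le> 0 then T (nat (- m)) else zero_lmod),
      bdry = (\<lambda>m. if - int k \<le> m \<and> m < 0 then \<phi> (nat (- m)) else (\<lambda>_. 0))\<rparr>"

definition Hom_Com ::
  "('a, 'm::ab_group_add) cpx \<Rightarrow> ('a, 'n::ab_group_add) cpx \<Rightarrow> (int \<Rightarrow> 'm \<Rightarrow> 'n) set" where
  "Hom_Com C D =
     {g. (\<forall>m. g m \<in> Hom (obj C m) (obj D m)) \<and> (\<forall>m. bdry D m \<circ> g m = g (m + 1) \<circ> bdry C m)}"

definition com_scale ::
  "('k \<Rightarrow> 'a::ring_1 \<Rightarrow> 'a) \<Rightarrow> ('a, 'n) cpx \<Rightarrow> 'k \<Rightarrow> (int \<Rightarrow> 'm \<Rightarrow> 'n) \<Rightarrow> int \<Rightarrow> 'm \<Rightarrow> 'n" where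
  "com_scale scale D c g = (\<lambda>m. hom_scale scale (obj D m) c (g m))"

definition null_homotopic ::
  "('a, 'm::ab_group_add) cpx \<Rightarrow> ('a, 'n::ab_group_add) cpx \<Rightarrow> (int \<Rightarrow> 'm \<Rightarrow> 'n) \<Rightarrow> bool" where
  "null_homotopic C D g \<longleftrightarrow>
     (\<exists>s. (\<forall>m. s m \<in> Hom (obj C m) (obj D (m - 1))) \<and>
          (\<forall>m x. g m x = bdry D (m - 1) (s m x) + s (m + 1) (bdry C m x)))"

definition homotopy_class ::
  "('a, 'm::ab_group_add) cpx \<Rightarrow> ('a, 'n::ab_group_add) cpx \<Rightarrow> (int \<Rightarrow> 'm \<Rightarrow> 'n) \<Rightarrow>
     (int \<Rightarrow> 'm \<Rightarrow> 'n) set" where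
  "homotopy_class C D g = {h \<in> Hom_Com C D. null_homotopic C D (h - g)}"

text \<open>
  The space of homotopy classes with its vector space operations. For \<open>C\<close> the complex of tilting
  modules of \<open>\<nabla>\<close> and \<open>D = \<nabla>[l]\<close> this is the extension space in degree \<open>l\<close>.
\<close>

definition Ext_space ::
  "('a, 'm::ab_group_add) cpx \<Rightarrow> ('a, 'n::ab_group_add) cpx \<Rightarrow> (int \<Rightarrow> 'm \<Rightarrow> 'n) set set" where
  "Ext_space C D = homotopy_class C D ` Hom_Com C D"

definition Ext_add ::
  "('a, 'm::ab_group_add) cpx \<Rightarrow> ('a, 'n::ab_group_add) cpx \<Rightarrow>
     (int \<Rightarrow> 'm \<Rightarrow> 'n) set \<Rightarrow> (int \<Rightarrow> 'm \<Rightarrow> 'n) set \<Rightarrow> (int \<Rightarrow> 'm \<Rightarrow> 'n) set" where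
  "Ext_add C D X Y = (\<Union>g\<in>X. \<Union>h\<in>Y. homotopy_class C D (g + h))"

definition Ext_scale ::
  "('k \<Rightarrow> 'a::ring_1 \<Rightarrow> 'a) \<Rightarrow> ('a, 'm::ab_group_add) cpx \<Rightarrow> ('a, 'n::ab_group_add) cpx \<Rightarrow>
     'k \<Rightarrow> (int \<Rightarrow> 'm \<Rightarrow> 'n) set \<Rightarrow> (int \<Rightarrow> 'm \<Rightarrow> 'n) set" where
  "Ext_scale scale C D c X = (\<Union>g\<in>X. homotopy_class C D (com_scale scale D c g))"

text \<open>The composite of the projection to \<open>Delta i\<close>, the map \<open>\<alpha> i\<close> and the inclusion.\<close>

definition component_map :: "(nat \<Rightarrow> 'd \<Rightarrow> 'c::zero) \<Rightarrow> nat \<Rightarrow> (nat \<Rightarrow> 'd) \<Rightarrow> nat \<Rightarrow> 'c" where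
  "component_map \<alpha> i x = (\<lambda>j. if j = i then \<alpha> i (x i) else 0)"

definition pairing ::
  "('k::field \<Rightarrow> 'a::ring_1 \<Rightarrow> 'a) \<Rightarrow> nat \<Rightarrow> (nat \<Rightarrow> ('a, 'd::ab_group_add) lmod) \<Rightarrow>
     (nat \<Rightarrow> ('a, 'c::ab_group_add) lmod) \<Rightarrow> (nat \<Rightarrow> 'd \<Rightarrow> 'c) \<Rightarrow>
     ((nat \<Rightarrow> 'd) \<Rightarrow> 't) \<Rightarrow> ('t \<Rightarrow> nat \<Rightarrow> 'c) \<Rightarrow> 'k" where
  "pairing scale n Delta Nabla \<alpha> f g =
     (THE s. \<exists>a. (\<forall>x\<in>car (dsum n Delta).
                    (g \<circ> f) x = (\<Sum>i\<in>{1..n}. scalar scale (dsum n Nabla) (a i) (component_map \<alpha> i x))) \<and>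
                 s = (\<Sum>i\<in>{1..n}. a i))"

definition bilinear_on ::
  "'v set \<Rightarrow> ('v \<Rightarrow> 'v \<Rightarrow> 'v) \<Rightarrow> ('k \<Rightarrow> 'v \<Rightarrow> 'v) \<Rightarrow>
     'w set \<Rightarrow> ('w \<Rightarrow> 'w \<Rightarrow> 'w) \<Rightarrow> ('k \<Rightarrow> 'w \<Rightarrow> 'w) \<Rightarrow> ('v \<Rightarrow> 'w \<Rightarrow> 'k::field) \<Rightarrow> bool" where
  "bilinear_on V addV scaleV W addW scaleW B \<longleftrightarrow>
     (\<forall>v\<in>V. \<forall>v'\<in>V. \<forall>w\<in>W. B (addV v v') w = B v w + B v' w) \<and>
     (\<forall>c. \<forall>v\<in>V. \<forall>w\<in>W. B (scaleV c v) w = c * B v w) \<and>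
     (\<forall>v\<in>V. \<forall>w\<in>W. \<forall>w'\<in>W. B v (addW w w') = B v w + B v w') \<and>
     (\<forall>c. \<forall>v\<in>V. \<forall>w\<in>W. B v (scaleW c w) = c * B v w)"

end

theory Submission
  imports Defs
begin

text \<open>
  If \<open>g = s \<circ> \<phi>\<^sub>l\<close> is homotopic to zero, then not only the sum but each single coefficient of
  \<open>g \<circ> f\<close> vanishes. Otherwise some composite \<open>\<Delta>(i) \<rightarrow> T\<^sub>l \<rightarrow> T\<^sub>l\<^sub>-\<^sub>1 \<rightarrow> \<nabla>(i)\<close> is
  non-zero, which for the indecomposable tilting module \<open>T(i)\<close> means that \<open>\<phi>\<^sub>l\<close> induces an
  isomorphism on a common summand \<open>T(i)\<close>, against minimality. The modules \<open>T(i)\<close> are avoided as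
  follows. As \<open>T\<^sub>l\<^sub>-\<^sub>1\<close> has a standard filtration and first extensions of standard by costandard
  modules vanish, there is a map \<open>\<psi>\<close> from \<open>T\<^sub>l\<^sub>-\<^sub>1\<close> to \<open>T\<^sub>l\<close> such that \<open>\<psi> \<circ> \<phi>\<^sub>l\<close> fixes the
  image of the generator of \<open>\<Delta>(i)\<close> up to elements that every map to \<open>\<nabla>(i)\<close> kills. So
  \<open>\<psi> \<circ> \<phi>\<^sub>l\<close> is not nilpotent, and Fitting's lemma provides a common summand.
\<close>

subsection \<open>Modules and homomorphisms\<close>

text \<open>The argument follows one vector, the image \<open>x\<close> of the generator of
  \<Delta>(i) in T_l. A non-zero composite means that some map to \<nabla>(i) through T_(l-1) sees
  \<open>x\<close>, and being seen survives iteration: if \<psi> \<circ> \<phi>_l preserves the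
  value at \<open>x\<close> of every map from T_l to \<nabla>(i), then so do its powers, and testing
  against the given composite shows that no power kills \<open>x\<close>. Fixing \<open>x\<close>
  itself is not asked for, because factors \<Delta>(m) with m > i of T_(l-1) may contribute to
  \<phi>_l(x); such contributions can be subtracted since \<nabla>(i) does not see them. The
  filtrations have separate tasks. The standard filtration of T_(l-1) is the ladder along which
  \<psi> is built, the costandard filtration of T_l removes the obstruction to extending \<psi> at
  each rung, and the standard filtration of T_l supplies the finite length behind Fitting's
  lemma.\<close>

lemma lmoduleD:
  assumes "lmodule M"
  shows lmodule_zero: "0 \<in> car M"
    and lmodule_add: "x \<in> car M \<Longrightarrow> y \<in> car M \<Longrightarrow> x + y \<in> car M"
    and lmodule_uminus: "x \<in> car M \<Longrightarrow> - x \<in> car M"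
    and lmodule_act: "x \<in> car M \<Longrightarrow> act M a x \<in> car M"
    and act_add_right: "x \<in> car M \<Longrightarrow> y \<in> car M \<Longrightarrow> act M a (x + y) = act M a x + act M a y"
    and act_add_left: "x \<in> car M \<Longrightarrow> act M (a + b) x = act M a x + act M b x"
    and act_mult: "x \<in> car M \<Longrightarrow> act M (a * b) x = act M a (act M b x)"
    and act_one: "x \<in> car M \<Longrightarrow> act M 1 x = x"
  using assms unfolding lmodule_def by blast+

lemma lmodule_act_zero:
  assumes "lmodule M"
  shows act_zero_right: "act M a 0 = 0"
    and act_zero_left: "x \<in> car M \<Longrightarrow> act M 0 x = 0"
proof -
  show "act M a 0 = 0"
    using act_add_right[OF assms lmodule_zero[OF assms] lmodule_zero[OF assms], of a] by simp
  show "act M 0 x = 0" if "x \<in> car M"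
    using act_add_left[OF assms that, of 0 0] by simp
qed

lemma lmodule_diff:
  assumes "lmodule M"
  shows lmodule_minus: "x \<in> car M \<Longrightarrow> y \<in> car M \<Longrightarrow> x - y \<in> car M"
    and act_uminus_right: "x \<in> car M \<Longrightarrow> act M a (- x) = - act M a x"
    and act_uminus_left: "x \<in> car M \<Longrightarrow> act M (- a) x = - act M a x"
    and act_diff_right: "x \<in> car M \<Longrightarrow> y \<in> car M \<Longrightarrow> act M a (x - y) = act M a x - act M a y"
    and act_diff_left: "x \<in> car M \<Longrightarrow> act M (a - b) x = act M a x - act M b x"
proof -
  note m = lmoduleD[OF assms] lmodule_act_zero[OF assms]
  show 1: "x - y \<in> car M" if "x \<in> car M" "y \<in> car M" for x y
    using m(2)[OF that(1) m(3)[OF that(2)]] by simp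
  show 2: "act M a (- x) = - act M a x" if "x \<in> car M" for x
  proof -
    have "act M a x + act M a (- x) = 0"
      using m(5)[OF that m(3)[OF that], of a] m(9) by simp
    then show ?thesis by (metis add_eq_0_iff)
  qed
  show 3: "act M (- a) x = - act M a x" if "x \<in> car M" for x a
  proof -
    have "act M a x + act M (- a) x = 0"
      using m(6)[OF that, of a "- a"] m(10)[OF that] by simp
    then show ?thesis by (metis add_eq_0_iff)
  qed
  show "act M a (x - y) = act M a x - act M a y" if "x \<in> car M" "y \<in> car M"
    using m(5)[OF that(1) m(3)[OF that(2)], of a] 2[OF that(2)] by simp
  show "act M (a - b) x = act M a x - act M b x" if "x \<in> car M"
    using m(6)[OF that, of a "- b"] 3[OF that] by simp
qed

lemma lmodule_sum:
  assumes "lmodule M" "\<And>i. i \<in> I \<Longrightarrow> x i \<in> car M"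
  shows "sum x I \<in> car M"
  using assms(2)
  by (induction I rule: infinite_finite_induct)
    (auto intro: lmoduleD(1,2)[OF assms(1)])

text \<open>Closure under negation comes from -x = (-1)x, and the module identities are inherited
  from \<open>M\<close>.\<close>

lemma submodule_iff:
  assumes "lmodule M"
  shows "submodule V M \<longleftrightarrow> V \<subseteq> car M \<and> 0 \<in> V \<and> (\<forall>x\<in>V. \<forall>y\<in>V. x + y \<in> V) \<and>
    (\<forall>a. \<forall>x\<in>V. act M a x \<in> V)"
proof -
  have "- x \<in> V" if "V \<subseteq> car M" "\<forall>a. \<forall>x\<in>V. act M a x \<in> V" "x \<in> V" for x
    using that act_uminus_left[OF assms, of x 1] act_one[OF assms, of x]
    by (metis subset_eq)
  then show ?thesis
    unfolding submodule_def lmodule_def using lmoduleD(5-8)[OF assms]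
    by (auto simp: subset_eq)
qed

lemma submodule_lmodule: "submodule V M \<Longrightarrow> lmodule (M\<lparr>car := V\<rparr>)"
  and submodule_subset: "submodule V M \<Longrightarrow> V \<subseteq> car M"
  by (auto simp: submodule_def)

lemma submodule_restrict:
  assumes "submodule V M" "V \<subseteq> U"
  shows "submodule V (M\<lparr>car := U\<rparr>)"
  using assms by (simp add: submodule_def)

lemma HomD:
  assumes "f \<in> Hom M N"
  shows Hom_car: "x \<in> car M \<Longrightarrow> f x \<in> car N"
    and Hom_outside: "x \<notin> car M \<Longrightarrow> f x = 0"
    and Hom_add: "x \<in> car M \<Longrightarrow> y \<in> car M \<Longrightarrow> f (x + y) = f x + f y"
    and Hom_act: "x \<in> car M \<Longrightarrow> f (act M a x) = act N a (f x)"
  using assms by (auto simp: Hom_def)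

lemma HomI:
  assumes "\<And>x. x \<in> car M \<Longrightarrow> f x \<in> car N" "\<And>x. x \<notin> car M \<Longrightarrow> f x = 0"
    "\<And>x y. x \<in> car M \<Longrightarrow> y \<in> car M \<Longrightarrow> f (x + y) = f x + f y"
    "\<And>a x. x \<in> car M \<Longrightarrow> f (act M a x) = act N a (f x)"
  shows "f \<in> Hom M N"
  using assms by (auto simp: Hom_def)

lemma Hom_zero:
  assumes "f \<in> Hom M N" "lmodule M"
  shows "f 0 = 0"
  using Hom_add[OF assms(1) lmodule_zero[OF assms(2)] lmodule_zero[OF assms(2)]] by simp

lemma Hom_diff:
  assumes "f \<in> Hom M N" "lmodule M" "x \<in> car M" "y \<in> car M"
  shows "f (x - y) = f x - f y"
  using Hom_add[OF assms(1) lmodule_minus[OF assms(2-4)] assms(4)] by (simp add: algebra_simps)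

lemma Hom_sum:
  assumes "f \<in> Hom M N" "lmodule M" "\<And>i. i \<in> I \<Longrightarrow> x i \<in> car M"
  shows "f (sum x I) = (\<Sum>i\<in>I. f (x i))"
  using assms(3)
proof (induction I rule: infinite_finite_induct)
  case (insert i I)
  then show ?case
    using Hom_add[OF assms(1), of "x i" "sum x I"] lmodule_sum[OF assms(2), of I x] by simp
qed (simp_all add: Hom_zero[OF assms(1,2)])

lemma Hom_in_car:
  assumes "f \<in> Hom M N" "lmodule N"
  shows "f x \<in> car N"
  using HomD(1,2)[OF assms(1)] lmodule_zero[OF assms(2)] by (cases "x \<in> car M") auto

lemma Hom_comp:
  assumes "f \<in> Hom M N" "g \<in> Hom N P" "lmodule N"
  shows "g \<circ> f \<in> Hom M P"
  by (rule HomI) (simp_all add: HomD[OF assms(1)] HomD[OF assms(2)] Hom_zero[OF assms(2,3)])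

lemma Hom_plus:
  assumes "f \<in> Hom M N" "g \<in> Hom M N" "lmodule N"
  shows "f + g \<in> Hom M N"
  by (rule HomI)
    (simp_all add: HomD[OF assms(1)] HomD[OF assms(2)] lmoduleD[OF assms(3)] algebra_simps)

lemma Hom_uminus:
  assumes "f \<in> Hom M N" "lmodule N"
  shows "- f \<in> Hom M N"
  by (rule HomI)
    (simp_all add: HomD[OF assms(1)] lmoduleD[OF assms(2)] act_uminus_right[OF assms(2)])

lemma Hom_image_submodule:
  assumes "f \<in> Hom M N" "lmodule M" "lmodule N" "submodule V M"
  shows "submodule (f ` V) N"
  unfolding submodule_iff[OF assms(3)]
proof (intro conjI ballI allI)
  note V = assms(4)[unfolded submodule_iff[OF assms(2)]]
  show "f ` V \<subseteq> car N" using V HomD(1)[OF assms(1)] by auto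
  show "0 \<in> f ` V" using V Hom_zero[OF assms(1,2)] by force
  show "x + y \<in> f ` V" if xy: "x \<in> f ` V" "y \<in> f ` V" for x y
  proof -
    obtain u v where "u \<in> V" "v \<in> V" "x = f u" "y = f v" using xy by blast
    then show ?thesis using V HomD(3)[OF assms(1), of u v]
      by (intro image_eqI[of _ _ "u + v"]) (auto simp: subset_eq)
  qed
  show "act N a x \<in> f ` V" if x: "x \<in> f ` V" for a x
  proof -
    obtain u where "u \<in> V" "x = f u" using x by blast
    then show ?thesis
      using V HomD(4)[OF assms(1), of u a]
      by (intro image_eqI[of _ _ "act M a u"]) (auto simp: subset_eq)
  qed
qed

lemma submodule_car: "lmodule M \<Longrightarrow> submodule (car M) M"
  by (simp add: submodule_def)

text \<open>Since U' = U + Az, an extension of \<open>f\<close> is fixed by the image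
  \<open>t\<close> of \<open>z\<close>, and it exists once \<open>t\<close> satisfies every relation
  that puts a multiple of \<open>z\<close> into \<open>U\<close>. The lemma serves to climb a
  filtration, to build endomorphisms of \<Delta>(i), and to build maps that kill
  \<open>U\<close>.\<close>

lemma glue_cyclic:
  assumes M: "lmodule M" and T: "lmodule T" and U: "submodule U M" and U': "submodule U' M"
    and sub: "U \<subseteq> U'" and z: "z \<in> U'" and t: "t \<in> car T"
    and gen: "\<And>x. x \<in> U' \<Longrightarrow> \<exists>a. x - act M a z \<in> U"
    and f: "f \<in> Hom (M\<lparr>car := U\<rparr>) T"
    and compat: "\<And>a. act M a z \<in> U \<Longrightarrow> f (act M a z) = act T a t"
  obtains g where "g \<in> Hom (M\<lparr>car := U'\<rparr>) T" "\<And>x. x \<in> U \<Longrightarrow> g x = f x" "g z = t"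
proof -
  define c where "c x = (SOME a. x - act M a z \<in> U)" for x
  define g where "g x = (if x \<in> U' then f (x - act M (c x) z) + act T (c x) t else 0)" for x
  have zM: "z \<in> car M" using z U' by (auto simp: submodule_def)
  have UM: "lmodule (M\<lparr>car := U\<rparr>)" using U by (simp add: submodule_def)
  have UM': "lmodule (M\<lparr>car := U'\<rparr>)" using U' by (simp add: submodule_def)
  have fU: "f x \<in> car T" if "x \<in> U" for x using Hom_car[OF f, of x] that by simp
  have fadd: "f (x + y) = f x + f y" if "x \<in> U" "y \<in> U" for x y
    using Hom_add[OF f, of x y] that by simp
  have fdiff: "f (x - y) = f x - f y" if "x \<in> U" "y \<in> U" for x y
    using Hom_diff[OF f UM, of x y] that by simp
  have fact: "f (act M a x) = act T a (f x)" if "x \<in> U" for x a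
    using Hom_act[OF f, of x a] that by simp
  have Ucl: "x + y \<in> U" "x - y \<in> U" "act M a x \<in> U" "x \<in> car M" "0 \<in> U"
    if "x \<in> U" "y \<in> U" for x y a
    using that lmoduleD[OF UM] lmodule_minus[OF UM] submodule_subset[OF U] by auto
  have Ucl': "x + y \<in> U'" "act M a x \<in> U'" "x \<in> car M"
    if "x \<in> U'" "y \<in> U'" for x y a
    using that lmoduleD[OF UM'] submodule_subset[OF U'] by auto
  \<comment> \<open>Any coefficient of \<open>x\<close> along \<open>z\<close> gives the same value:
    two of them differ by some b with bz in \<open>U\<close>, where \<open>compat\<close> applies.
    Additivity and linearity can then be checked with convenient coefficients.\<close>
  have key: "g x = f (x - act M a z) + act T a t" if x: "x \<in> U'" and a: "x - act M a z \<in> U" for x a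
  proof -
    have c: "x - act M (c x) z \<in> U" unfolding c_def by (rule someI[of _ a]) (rule a)
    have e: "act M (a - c x) z = (x - act M (c x) z) - (x - act M a z)"
      by (simp add: act_diff_left[OF M zM])
    then have "f (act M (a - c x) z) = act T (a - c x) t"
      using compat[of "a - c x"] Ucl(2)[OF c a] unfolding e by simp
    then have "f (x - act M (c x) z) - f (x - act M a z) = act T a t - act T (c x) t"
      using e fdiff[OF c a] act_diff_left[OF T t] by simp
    then show ?thesis using x by (simp add: g_def algebra_simps)
  qed
  show thesis
  proof
    show "g \<in> Hom (M\<lparr>car := U'\<rparr>) T"
    proof (rule HomI; simp)
      fix x assume x: "x \<in> U'"
      obtain a where a: "x - act M a z \<in> U" using gen[OF x] by blast
      show "g x \<in> car T"
        unfolding key[OF x a] using fU[OF a] lmoduleD[OF T] t by simp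
      fix b
      have "act M b x - act M (b * a) z = act M b (x - act M a z)"
        using Ucl'[OF x x] zM by (simp add: act_diff_right[OF M] lmoduleD[OF M])
      moreover have "act M b (x - act M a z) \<in> U" using Ucl[OF a a] by blast
      ultimately show "g (act M b x) = act T b (g x)"
        using key[OF Ucl'(2)[OF x x], of b "b * a"] key[OF x a] fact[OF a] fU[OF a] t
        by (simp add: lmoduleD[OF T])
    next
      fix x y assume x: "x \<in> U'" and y: "y \<in> U'"
      obtain a b where a: "x - act M a z \<in> U" and b: "y - act M b z \<in> U"
        using gen[OF x] gen[OF y] by blast
      have "x + y - act M (a + b) z = (x - act M a z) + (y - act M b z)"
        by (simp add: lmoduleD[OF M] zM algebra_simps)
      then have "x + y - act M (a + b) z \<in> U"
        "f (x + y - act M (a + b) z) = f (x - act M a z) + f (y - act M b z)"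
        using Ucl(1)[OF a b] fadd[OF a b] by metis+
      then show "g (x + y) = g x + g y"
        using key[OF Ucl'(1)[OF x y], of "a + b"] key[OF x a] key[OF y b] t
        by (simp add: lmoduleD[OF T])
    qed (simp add: g_def)
    show "g x = f x" if "x \<in> U" for x
      using key[of x 0] that sub t by (auto simp: lmodule_act_zero[OF M] lmodule_act_zero[OF T] zM)
    have U0: "0 \<in> U" using lmodule_zero[OF UM] by simp
    show "g z = t"
      using key[OF z, of 1] U0 t zM Hom_zero[OF f UM] by (simp add: lmoduleD[OF M] lmoduleD[OF T])
  qed
qed

subsection \<open>Finite length and Fitting's lemma\<close>

text \<open>A strictly monotone rank with values in the natural numbers bounds the length of all
  chains of submodules, without reference to composition series. For the projectives it will be the
  dimension.\<close>

definition finite_length :: "('a::ring_1, 'm::ab_group_add) lmod \<Rightarrow> bool" where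
  "finite_length M \<longleftrightarrow> (\<exists>\<rho>::'m set \<Rightarrow> nat.
     \<forall>V W. submodule V M \<longrightarrow> submodule W M \<longrightarrow> V \<subset> W \<longrightarrow> \<rho> V < \<rho> W)"

text \<open>Taking preimages embeds the submodules of \<open>X\<close> strictly monotonically into
  those of \<open>M\<close>, so the rank can be pulled back.\<close>

lemma finite_length_image:
  assumes "lmodule M" "lmodule X" "p \<in> Hom M X" "p ` car M = car X" "finite_length M"
  shows "finite_length X"
proof -
  obtain \<rho> where \<rho>: "\<And>V W. submodule V M \<Longrightarrow> submodule W M \<Longrightarrow> V \<subset> W \<Longrightarrow> \<rho> V < (\<rho> W :: nat)"
    using assms(5) unfolding finite_length_def by blast
  define P where "P V = {x \<in> car M. p x \<in> V}" for V
  have sub: "submodule (P V) M" if "submodule V X" for V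
    using that unfolding submodule_iff[OF assms(1)] submodule_iff[OF assms(2)] P_def
    by (auto simp: HomD[OF assms(3)] lmoduleD[OF assms(1)] Hom_zero[OF assms(3,1)])
  have strict: "P V \<subset> P W" if VW: "V \<subset> W" "W \<subseteq> car X" for V W
  proof -
    obtain y where y: "y \<in> W" "y \<notin> V" using VW by blast
    then have "y \<in> p ` car M" using VW assms(4) by blast
    then obtain x where "x \<in> car M" "p x = y" by blast
    then show ?thesis using VW(1) y unfolding P_def by blast
  qed
  have "\<rho> (P V) < \<rho> (P W)" if "submodule V X" "submodule W X" "V \<subset> W" for V W
    using \<rho>[OF sub[OF that(1)] sub[OF that(2)] strict[OF that(3) submodule_subset[OF that(2)]]] .
  then show ?thesis
    unfolding finite_length_def by (intro exI[of _ "\<lambda>V. \<rho> (P V)"]) blast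
qed

text \<open>Nested submodules with the same intersection with \<open>U\<close> and the same image in
  \<open>X\<close> coincide. Hence the sum of the ranks of these two pieces is strictly
  monotone.\<close>

lemma finite_length_extension:
  assumes M: "lmodule M" and X: "lmodule X" and U: "submodule U M" "finite_length (M\<lparr>car := U\<rparr>)"
    and fX: "finite_length X" and q: "quotient_iso M U X"
  shows "finite_length M"
proof -
  obtain p where p: "p \<in> Hom M X" and ker: "{x \<in> car M. p x = 0} = U"
    using q unfolding quotient_iso_def by blast
  obtain \<rho> where \<rho>: "\<And>V W. submodule V (M\<lparr>car := U\<rparr>) \<Longrightarrow> submodule W (M\<lparr>car := U\<rparr>) \<Longrightarrow> V \<subset> W
      \<Longrightarrow> \<rho> V < (\<rho> W :: nat)"
    using U(2) unfolding finite_length_def by blast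
  obtain \<sigma> where \<sigma>: "\<And>V W. submodule V X \<Longrightarrow> submodule W X \<Longrightarrow> V \<subset> W \<Longrightarrow> \<sigma> V < (\<sigma> W :: nat)"
    using fX unfolding finite_length_def by blast
  have "\<rho> (V \<inter> U) + \<sigma> (p ` V) < \<rho> (W \<inter> U) + \<sigma> (p ` W)"
    if V: "submodule V M" and W: "submodule W M" and VW: "V \<subset> W" for V W
  proof -
    have int: "submodule (Z \<inter> U) (M\<lparr>car := U\<rparr>)" if "submodule Z M" for Z
    proof -
      have "submodule (Z \<inter> U) M"
        using that U(1) unfolding submodule_iff[OF M] by blast
      then show ?thesis by (rule submodule_restrict) simp
    qed
    have im: "submodule (p ` Z) X" if "submodule Z M" for Z
      by (rule Hom_image_submodule[OF p M X that])
    have a: "\<rho> (V \<inter> U) \<le> \<rho> (W \<inter> U)"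
      using \<rho>[OF int[OF V] int[OF W]] VW by (metis Int_mono less_imp_le order_refl psubsetI psubsetE)
    have b: "\<sigma> (p ` V) \<le> \<sigma> (p ` W)"
      using \<sigma>[OF im[OF V] im[OF W]] VW by (metis image_mono less_imp_le order_refl psubsetI psubsetE)
    have "V \<inter> U \<noteq> W \<inter> U \<or> p ` V \<noteq> p ` W"
    proof (rule ccontr)
      assume "\<not> ?thesis"
      then have eq: "V \<inter> U = W \<inter> U" "p ` V = p ` W" by auto
      obtain w where w: "w \<in> W" "w \<notin> V" using VW by blast
      then obtain v where v: "v \<in> V" "p v = p w" using eq(2) by (metis imageE imageI)
      have c: "v \<in> car M" "w \<in> car M" using v w V W by (auto simp: submodule_def)
      have "w - v \<in> W" using lmodule_minus[OF submodule_lmodule[OF W], of w v] v w VW by auto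
      moreover have "p (w - v) = 0" using Hom_diff[OF p M c(2,1)] v by simp
      then have "w - v \<in> U" using ker lmodule_minus[OF M c(2,1)] by blast
      ultimately have "w - v \<in> V" using eq by blast
      then have "w \<in> V" using lmodule_add[OF submodule_lmodule[OF V], of "w - v" v] v by simp
      with w show False by simp
    qed
    then show ?thesis
    proof
      assume "V \<inter> U \<noteq> W \<inter> U"
      then have "\<rho> (V \<inter> U) < \<rho> (W \<inter> U)" using \<rho>[OF int[OF V] int[OF W]] VW by blast
      with b show ?thesis by simp
    next
      assume "p ` V \<noteq> p ` W"
      then have "\<sigma> (p ` V) < \<sigma> (p ` W)" using \<sigma>[OF im[OF V] im[OF W]] VW by blast
      with a show ?thesis by simp
    qed
  qed
  then show ?thesis
    unfolding finite_length_def by (intro exI[of _ "\<lambda>V. \<rho> (V \<inter> U) + \<sigma> (p ` V)"]) blast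
qed

text \<open>Powers of \<theta> need not lie in \<open>Hom M M\<close>: the zeroth one is the
  identity, which does not vanish outside the carrier. Linearity of powers is therefore recorded on
  the carrier only.\<close>

lemma Hom_funpow:
  assumes "\<theta> \<in> Hom M M" "lmodule M"
  shows Hom_funpow_car: "x \<in> car M \<Longrightarrow> (\<theta> ^^ j) x \<in> car M"
    and Hom_funpow_add: "x \<in> car M \<Longrightarrow> y \<in> car M \<Longrightarrow> (\<theta> ^^ j) (x + y) = (\<theta> ^^ j) x + (\<theta> ^^ j) y"
    and Hom_funpow_act: "x \<in> car M \<Longrightarrow> (\<theta> ^^ j) (act M a x) = act M a ((\<theta> ^^ j) x)"
proof -
  show 1: "(\<theta> ^^ j) x \<in> car M" if "x \<in> car M" for j x
    using that by (induction j) (auto simp: HomD[OF assms(1)])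
  show "(\<theta> ^^ j) (x + y) = (\<theta> ^^ j) x + (\<theta> ^^ j) y" if "x \<in> car M" "y \<in> car M"
    using that by (induction j) (auto simp: HomD[OF assms(1)] 1)
  show "(\<theta> ^^ j) (act M a x) = act M a ((\<theta> ^^ j) x)" if "x \<in> car M"
    using that by (induction j) (auto simp: HomD[OF assms(1)] 1)
qed

lemma funpow_image_submodule:
  assumes "\<theta> \<in> Hom M M" "lmodule M"
  shows "submodule ((\<theta> ^^ j) ` car M) M"
proof (induction j)
  case (Suc j)
  then show ?case
    using Hom_image_submodule[OF assms(1,2,2) Suc] by (simp add: image_comp)
qed (simp add: submodule_car[OF assms(2)])

lemma fitting_stable:
  assumes \<theta>: "\<theta> \<in> Hom M M" and M: "lmodule M" and fin: "finite_length M"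
  obtains N where "\<And>x. x \<in> (\<theta> ^^ N) ` car M \<Longrightarrow> \<theta> x = 0 \<Longrightarrow> x = 0"
    "\<theta> ` (\<theta> ^^ N) ` car M = (\<theta> ^^ N) ` car M"
proof -
  obtain \<rho> where \<rho>: "\<And>V W. submodule V M \<Longrightarrow> submodule W M \<Longrightarrow> V \<subset> W \<Longrightarrow> \<rho> V < (\<rho> W :: nat)"
    using fin unfolding finite_length_def by blast
  note pw = Hom_funpow[OF \<theta> M] and m = lmoduleD[OF M]
  have p0: "(\<theta> ^^ j) 0 = 0" for j using pw(2)[OF m(1,1), of j] by simp
  define K where "K j = {x \<in> car M. (\<theta> ^^ j) x = 0}" for j
  define I where "I j = (\<theta> ^^ j) ` car M" for j
  have K: "submodule (K j) M" for j
    unfolding submodule_iff[OF M] K_def by (auto simp: m pw p0 act_zero_right[OF M])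
  have I: "submodule (I j) M" for j
    unfolding I_def by (rule funpow_image_submodule[OF \<theta> M])
  have Kmono: "K i \<subseteq> K j" if "i \<le> j" for i j
  proof
    fix x assume x: "x \<in> K i"
    have "(\<theta> ^^ j) x = (\<theta> ^^ (j - i)) ((\<theta> ^^ i) x)"
      using that by (metis comp_apply funpow_add le_add_diff_inverse2)
    then show "x \<in> K j" using x by (simp add: K_def p0)
  qed
  have Imono: "I j \<subseteq> I i" if "i \<le> j" for i j
  proof
    fix y assume "y \<in> I j"
    then obtain x where x: "x \<in> car M" "y = (\<theta> ^^ j) x" by (auto simp: I_def)
    have "(\<theta> ^^ j) x = (\<theta> ^^ i) ((\<theta> ^^ (j - i)) x)"
      using that by (metis comp_apply funpow_add le_add_diff_inverse)
    then show "y \<in> I i" using x pw(1) by (auto simp: I_def)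
  qed
  have bound: "\<rho> (K j) \<le> \<rho> (car M)" for j
    using \<rho>[OF K submodule_car[OF M], of j] submodule_subset[OF K, of j]
    by (metis less_imp_le order_refl psubsetI)
  \<comment> \<open>The kernels ascend with bounded rank, so some kernel has maximal rank; the
    images descend, so some image has minimal rank. Beyond both indices kernels and images are
    constant.\<close>
  obtain a where a: "\<And>j. \<rho> (K j) \<le> \<rho> (K a)"
    using ex_has_greatest_nat[of "\<lambda>_. True" 0 "\<lambda>j. \<rho> (K j)" "Suc (\<rho> (car M))"] bound
    by (auto simp: less_Suc_eq_le)
  obtain b where b: "\<And>j. \<rho> (I b) \<le> \<rho> (I j)"
    using ex_has_least_nat[of "\<lambda>_. True" 0 "\<lambda>j. \<rho> (I j)"] by auto
  define N where "N = max a b"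
  have Keq: "K j = K a" if "a \<le> j" for j
    using \<rho>[OF K K, of a j] a[of j] Kmono[OF that] by (metis leD psubsetI)
  have Ieq: "I j = I b" if "b \<le> j" for j
    using \<rho>[OF I I, of j b] b[of j] Imono[OF that] by (metis leD psubsetI)
  show thesis
  proof
    show "x = 0" if x: "x \<in> (\<theta> ^^ N) ` car M" "\<theta> x = 0" for x
    proof -
      obtain y where y: "y \<in> car M" "x = (\<theta> ^^ N) y" using x by blast
      have "y \<in> K (Suc N)" using x y by (simp add: K_def)
      then have "y \<in> K N" using Keq[of "Suc N"] Keq[of N] by (simp add: N_def)
      then show "x = 0" using y by (simp add: K_def)
    qed
    have "\<theta> ` (\<theta> ^^ N) ` car M = I (Suc N)" by (simp add: I_def image_comp)
    also have "\<dots> = I N" using Ieq[of "Suc N"] Ieq[of N] by (simp add: N_def)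
    finally show "\<theta> ` (\<theta> ^^ N) ` car M = (\<theta> ^^ N) ` car M" by (simp add: I_def)
  qed
qed

text \<open>On its stable image \<open>X\<close> the endomorphism \<theta> = \<psi> \<circ> \<phi>
  is bijective, so \<phi> embeds \<open>X\<close> and \<psi>, up to an automorphism of
  \<open>X\<close>, splits this embedding. The vector \<open>x0\<close> guarantees that
  \<open>X\<close> is non-zero.\<close>

lemma nonnilpotent_common_summand:
  assumes M: "lmodule M" and N: "lmodule N" and fin: "finite_length M"
    and \<phi>: "\<phi> \<in> Hom M N" and \<psi>: "\<psi> \<in> Hom N M"
    and x0: "x0 \<in> car M" "\<And>j. ((\<psi> \<circ> \<phi>) ^^ j) x0 \<noteq> 0"
  shows "\<exists>X X' Y Y'. decomposes M X X' \<and> decomposes N Y Y' \<and> X \<noteq> {0} \<and>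
    bij_betw (\<lambda>x. projection Y Y' (\<phi> x)) X Y"
proof -
  define \<theta> where "\<theta> = \<psi> \<circ> \<phi>"
  have \<theta>: "\<theta> \<in> Hom M M" unfolding \<theta>_def by (rule Hom_comp[OF \<phi> \<psi> N])
  obtain j where inj: "\<And>x. x \<in> (\<theta> ^^ j) ` car M \<Longrightarrow> \<theta> x = 0 \<Longrightarrow> x = 0"
    and surj: "\<theta> ` (\<theta> ^^ j) ` car M = (\<theta> ^^ j) ` car M"
    using fitting_stable[OF \<theta> M fin] by metis
  note pw = Hom_funpow[OF \<theta> M] and m = lmoduleD[OF M] and nl = lmoduleD[OF N]
  have p0: "(\<theta> ^^ i) 0 = 0" for i using pw(2)[OF m(1,1), of i] by simp
  have pdiff: "(\<theta> ^^ i) (x - y) = (\<theta> ^^ i) x - (\<theta> ^^ i) y" if "x \<in> car M" "y \<in> car M" for i x y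
    using pw(2)[OF lmodule_minus[OF M that] that(2), of i] by (simp add: algebra_simps)
  define X where "X = (\<theta> ^^ j) ` car M"
  have X: "submodule X M"
    unfolding X_def by (rule funpow_image_submodule[OF \<theta> M])
  have XM: "X \<subseteq> car M" using submodule_subset[OF X] .
  have injX: "x = 0" if "x \<in> X" "(\<theta> ^^ i) x = 0" for x i
    using that
  proof (induction i arbitrary: x)
    case (Suc i)
    have "\<theta> x \<in> X" using Suc.prems(1) surj by (auto simp: X_def)
    moreover have "(\<theta> ^^ i) (\<theta> x) = 0" using Suc.prems(2) by (simp add: funpow_swap1)
    ultimately show ?case using Suc.IH inj Suc.prems(1) by (auto simp: X_def)
  qed simp
  have surjX: "(\<theta> ^^ i) ` X = X" for i
  proof (induction i)
    case (Suc i)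
    have "(\<theta> ^^ Suc i) ` X = \<theta> ` (\<theta> ^^ i) ` X" by (simp add: image_comp)
    also have "\<dots> = X" using Suc.IH surj by (simp add: X_def)
    finally show ?case .
  qed simp
  define X' where "X' = {x \<in> car M. (\<theta> ^^ j) x = 0}"
  define Y where "Y = \<phi> ` X"
  \<comment> \<open>The complement of \<open>Y\<close> is the kernel of \<theta>^j \<circ> \<psi>.
    It meets \<open>Y\<close> trivially because \<theta>^(j+1) is injective on \<open>X\<close>, and
    together they span \<open>N\<close> because \<theta>^(j+1) maps \<open>X\<close> onto
    \<open>X\<close>.\<close>
  define Y' where "Y' = {y \<in> car N. (\<theta> ^^ j) (\<psi> y) = 0}"
  have \<psi>0: "\<psi> 0 = 0" by (rule Hom_zero[OF \<psi> N])
  have \<phi>0: "\<phi> 0 = 0" by (rule Hom_zero[OF \<phi> M])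
  have X': "submodule X' M"
    unfolding submodule_iff[OF M] X'_def by (auto simp: m pw p0 act_zero_right[OF M])
  have Y: "submodule Y N" unfolding Y_def by (rule Hom_image_submodule[OF \<phi> M N X])
  have Y': "submodule Y' N"
    unfolding submodule_iff[OF N] Y'_def
    by (auto simp: nl HomD[OF \<psi>] \<psi>0 pw p0 act_zero_right[OF M])
  have dX: "decomposes M X X'"
    unfolding decomposes_def
  proof (intro conjI X X' ballI)
    show "X \<inter> X' = {0}"
      using injX lmodule_zero[OF submodule_lmodule[OF X]] lmodule_zero[OF submodule_lmodule[OF X']]
      by (auto simp: X'_def)
    fix x assume x: "x \<in> car M"
    then have "(\<theta> ^^ j) x \<in> (\<theta> ^^ j) ` X" unfolding surjX by (simp add: X_def)
    then obtain y where y: "y \<in> X" "(\<theta> ^^ j) x = (\<theta> ^^ j) y" by blast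
    then have "x - y \<in> X'"
      using x XM pdiff[of x y j] lmodule_minus[OF M, of x y] by (auto simp: X'_def)
    then show "\<exists>y\<in>X. \<exists>y'\<in>X'. x = y + y'" using y by (intro bexI[of _ y] bexI[of _ "x - y"]) auto
  qed
  have YY': "y = 0" if y: "y \<in> Y" "y \<in> Y'" for y
  proof -
    obtain x where x: "x \<in> X" "y = \<phi> x" using y by (auto simp: Y_def)
    then have "(\<theta> ^^ Suc j) x = 0" using y by (simp add: Y'_def \<theta>_def funpow_swap1)
    then show ?thesis using injX[OF x(1)] x \<phi>0 by blast
  qed
  have dY: "decomposes N Y Y'"
    unfolding decomposes_def
  proof (intro conjI Y Y' ballI)
    show "Y \<inter> Y' = {0}"
      using YY' lmodule_zero[OF submodule_lmodule[OF Y]] lmodule_zero[OF submodule_lmodule[OF Y']]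
      by auto
    fix y assume y: "y \<in> car N"
    have "(\<theta> ^^ j) (\<psi> y) \<in> (\<theta> ^^ Suc j) ` X"
      unfolding surjX using y by (auto simp: X_def HomD[OF \<psi>])
    then obtain x where x: "x \<in> X" "(\<theta> ^^ j) (\<psi> y) = (\<theta> ^^ j) (\<psi> (\<phi> x))"
      by (auto simp: \<theta>_def funpow_swap1)
    have c: "\<phi> x \<in> car N" using x XM HomD(1)[OF \<phi>] by auto
    have "y - \<phi> x \<in> Y'"
      using x y c pdiff[of "\<psi> y" "\<psi> (\<phi> x)" j] Hom_diff[OF \<psi> N y c] HomD(1)[OF \<psi>]
        lmodule_minus[OF N y c] by (simp add: Y'_def)
    then show "\<exists>u\<in>Y. \<exists>u'\<in>Y'. y = u + u'"
      using x by (intro bexI[of _ "\<phi> x"] bexI[of _ "y - \<phi> x"]) (auto simp: Y_def)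
  qed
  have proj: "projection Y Y' y = y" if "y \<in> Y" for y
    unfolding projection_def
  proof (rule the_equality)
    show "y \<in> Y \<and> y - y \<in> Y'" using that lmodule_zero[OF submodule_lmodule[OF Y']] by simp
    show "u = y" if "u \<in> Y \<and> y - u \<in> Y'" for u
      using YY'[of "y - u"] lmodule_minus[OF submodule_lmodule[OF Y], of y u] that \<open>y \<in> Y\<close> by simp
  qed
  have "inj_on \<phi> X"
  proof (rule inj_onI)
    fix x y assume xy: "x \<in> X" "y \<in> X" "\<phi> x = \<phi> y"
    have "\<phi> (x - y) = 0" using Hom_diff[OF \<phi> M, of x y] xy XM by auto
    then have "(\<theta> ^^ 1) (x - y) = 0" by (simp add: \<theta>_def \<psi>0)
    then show "x = y"
      using injX[of "x - y" 1] lmodule_minus[OF submodule_lmodule[OF X], of x y] xy by simp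
  qed
  then have "bij_betw \<phi> X Y" by (simp add: bij_betw_def Y_def)
  then have "bij_betw (\<lambda>x. projection Y Y' (\<phi> x)) X Y"
    by (rule bij_betw_cong[THEN iffD1, rotated]) (metis imageI proj Y_def)
  moreover have "X \<noteq> {0}" using x0 by (auto simp: X_def \<theta>_def)
  ultimately show ?thesis using dX dY by blast
qed

lemma finite_length_zero:
  assumes "car M = {0}"
  shows "finite_length M"
proof -
  have "V = {0}" if "submodule V M" for V
    using that lmodule_zero[OF submodule_lmodule[OF that]] submodule_subset[OF that] assms by auto
  then have "\<not> V \<subset> W" if "submodule V M" "submodule W M" for V W
    using that by blast
  then show ?thesis unfolding finite_length_def by blast
qed

text \<open>The predicate is about the members of the chain inside the fixed module
  \<open>M\<close>, so an induction step can refer to maps defined on all of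
  \<open>M\<close>.\<close>

lemma filtered_induct [consumes 2, case_names zero step]:
  assumes "filtered S M" "lmodule M"
    and zero: "submodule {0} M \<Longrightarrow> P {0}"
    and step: "\<And>U U' X. submodule U M \<Longrightarrow> submodule U' M \<Longrightarrow> U \<subseteq> U' \<Longrightarrow> X \<in> S \<Longrightarrow>
      quotient_iso (M\<lparr>car := U'\<rparr>) U X \<Longrightarrow> P U \<Longrightarrow> P U'"
  shows "P (car M)"
proof -
  obtain r U where U: "U 0 = {0}" "U r = car M" "\<forall>s\<le>r. submodule (U s) M"
    "\<forall>s<r. U s \<subseteq> U (Suc s) \<and> (\<exists>X\<in>S. quotient_iso (M\<lparr>car := U (Suc s)\<rparr>) (U s) X)"
    using assms(1) unfolding filtered_def by blast
  have "P (U s)" if "s \<le> r" for s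
    using that
  proof (induction s)
    case 0
    have "submodule (U 0) M" using U(3) by blast
    then show ?case using zero unfolding U(1) by blast
  next
    case (Suc s)
    then obtain X where "X \<in> S" "quotient_iso (M\<lparr>car := U (Suc s)\<rparr>) (U s) X"
      using U(4) by (meson Suc_le_lessD)
    then show ?case using step[of "U s" "U (Suc s)" X] U Suc by simp
  qed
  from this[of r] show ?thesis using U(2) by simp
qed

lemma filtered_finite_length:
  assumes "filtered S M" "lmodule M" "\<And>X. X \<in> S \<Longrightarrow> lmodule X \<and> finite_length X"
  shows "finite_length M"
proof -
  have "finite_length (M\<lparr>car := car M\<rparr>)"
  proof (rule filtered_induct[OF assms(1,2), where P = "\<lambda>U. finite_length (M\<lparr>car := U\<rparr>)"])
    show "finite_length (M\<lparr>car := {0}\<rparr>)" by (simp add: finite_length_zero)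
    fix U U' X
    assume "submodule U M" "submodule U' M" "U \<subseteq> U'" "X \<in> S"
      "quotient_iso (M\<lparr>car := U'\<rparr>) U X" "finite_length (M\<lparr>car := U\<rparr>)"
    then show "finite_length (M\<lparr>car := U'\<rparr>)"
      using assms(3)[of X] submodule_restrict[of U M U']
      by (intro finite_length_extension[OF submodule_lmodule[of U' M], of X U]) simp_all
  qed
  then show ?thesis by simp
qed

subsection \<open>Standard and costandard modules\<close>

lemma act_Proj [simp]: "act (Proj e i) = (*)"
  by (simp add: Proj_def)

lemma lmodule_Proj: "lmodule (Proj e i)"
proof -
  have car: "car (Proj e i) = range (\<lambda>a. a * e i)" by (auto simp: Proj_def)
  have "0 \<in> range (\<lambda>a. a * e i)" by (metis mult_zero_left rangeI)
  moreover have "a * e i + b * e i \<in> range (\<lambda>a. a * e i)" for a b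
    by (metis distrib_right rangeI)
  moreover have "- (a * e i) \<in> range (\<lambda>a. a * e i)" for a
    by (metis minus_mult_left rangeI)
  moreover have "b * (a * e i) \<in> range (\<lambda>a. a * e i)" for a b
    by (metis mult.assoc rangeI)
  ultimately show ?thesis
    unfolding lmodule_def car act_Proj by (auto simp: algebra_simps)
qed

lemma submodule_upper_trace: "submodule (upper_trace n e i) (Proj e i)"
proof -
  define F where "F = {U. submodule U (Proj e i) \<and>
         (\<forall>j\<in>{i<..n}. \<forall>f\<in>Hom (Proj e j) (Proj e i). f ` car (Proj e j) \<subseteq> U)}"
  have F: "car (Proj e i) \<in> F" "\<And>U. U \<in> F \<Longrightarrow> submodule U (Proj e i)"
    unfolding F_def using submodule_car[OF lmodule_Proj] HomD(1) by blast+
  have "submodule (\<Inter>F) (Proj e i)"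
    using F unfolding submodule_iff[OF lmodule_Proj] by blast
  then show ?thesis by (simp add: upper_trace_def F_def)
qed

section \<open>Scalars, linear functionals and dimension over the ground field\<close>

context fd_algebra
begin

lemma scale_one [simp]: "scale c 1 * a = scale c a" "a * scale c 1 = scale c a"
  using scale_mult_left[of c 1 a] scale_mult_right[of a c 1] by auto

lemma
  assumes "lmodule M" "x \<in> car M"
  shows scalar_car: "scalar scale M c x \<in> car M"
    and act_scalar: "act M a (scalar scale M c x) = scalar scale M c (act M a x)"
    and scalar_add_left: "scalar scale M (c + d) x = scalar scale M c x + scalar scale M d x"
    and scalar_mult: "scalar scale M (c * d) x = scalar scale M c (scalar scale M d x)"
    and scalar_one: "scalar scale M 1 x = x"
    and scalar_zero: "scalar scale M 0 x = 0"
    and scalar_add_right: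
      "y \<in> car M \<Longrightarrow> scalar scale M c (x + y) = scalar scale M c x + scalar scale M c y"
  proof -
  have "scale (c * d) 1 = scale c 1 * scale d 1" by simp
  then show "scalar scale M (c * d) x = scalar scale M c (scalar scale M d x)"
    using assms by (simp add: scalar_def act_mult del: scale_one)
qed (use assms in \<open>simp_all add: scalar_def lmoduleD act_zero_left scale_left_distrib
      flip: act_mult\<close>)

lemma scalar_eq_zero:
  assumes "lmodule M" "x \<in> car M" "scalar scale M c x = 0" "x \<noteq> 0"
  shows "c = 0"
proof (rule ccontr)
  assume "c \<noteq> 0"
  then have "x = scalar scale M (inverse c) (scalar scale M c x)"
    using scalar_mult[OF assms(1,2), of "inverse c" c] scalar_one[OF assms(1,2)] by simp
  also have "\<dots> = 0" using assms by (simp add: scalar_def act_zero_right)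
  finally show False using assms by simp
qed

lemma Hom_scalar:
  assumes "f \<in> Hom M N" "x \<in> car M"
  shows "f (scalar scale M c x) = scalar scale N c (f x)"
  using HomD(4)[OF assms] by (simp add: scalar_def)

lemma Hom_hom_scale:
  assumes "f \<in> Hom M N" "lmodule N"
  shows "hom_scale scale N c f \<in> Hom M N"
  using HomD[OF assms(1)]
  by (intro HomI) (simp_all add: hom_scale_def scalar_car[OF assms(2)] scalar_add_right[OF assms(2)]
      act_scalar[OF assms(2)], simp add: scalar_def act_zero_right[OF assms(2)])

lemma linear_functional_iff:
  "Vector_Spaces.linear scale (*) \<xi> \<longleftrightarrow>
     (\<forall>x y. \<xi> (x + y) = \<xi> x + \<xi> y) \<and> (\<forall>c x. \<xi> (scale c x) = c * \<xi> x)"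
proof -
  have "vector_space ((*) :: 'k \<Rightarrow> 'k \<Rightarrow> 'k)" by unfold_locales (simp_all add: algebra_simps)
  then show ?thesis using vector_space_axioms by (simp add: Vector_Spaces.linear_iff)
qed

text \<open>This is the source of the injectivity of the duals D(e_j A): a functional is extended
  from the upper trace to the whole algebra.\<close>

lemma linear_functional_extend:
  assumes S: "subspace S" and add: "\<And>x y. x \<in> S \<Longrightarrow> y \<in> S \<Longrightarrow> f (x + y) = f x + f y"
    and hom: "\<And>c x. x \<in> S \<Longrightarrow> f (scale c x) = c * f x"
  obtains g where "Vector_Spaces.linear scale (*) g" "\<And>x. x \<in> S \<Longrightarrow> g x = f x"
proof -
  have "vector_space ((*) :: 'k \<Rightarrow> 'k \<Rightarrow> 'k)" by unfold_locales (simp_all add: algebra_simps)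
  then interpret vector_space_pair scale "(*) :: 'k \<Rightarrow> 'k \<Rightarrow> 'k"
    using vector_space_axioms by (simp add: vector_space_pair_def)
  obtain B where B: "B \<subseteq> S" "independent B" "S \<subseteq> span B" using maximal_independent_subset by blast
  obtain g where g: "Vector_Spaces.linear scale (*) g" "\<And>x. x \<in> B \<Longrightarrow> g x = f x"
    using linear_independent_extend[OF B(2), of f] by blast
  note gl = g(1)[unfolded linear_functional_iff]
  have f0: "f 0 = 0" using hom[of 0 0] subspace_0[OF S] by simp
  have g0: "g 0 = 0" using gl[THEN conjunct2, rule_format, of 0 0] by simp
  have "subspace {x \<in> S. g x = f x}"
    unfolding subspace_def
    using gl add hom subspace_0[OF S] subspace_add[OF S] subspace_scale[OF S] by (auto simp: f0 g0)
  then have "S \<subseteq> {x \<in> S. g x = f x}"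
    using span_minimal[of B "{x \<in> S. g x = f x}"] B g(2) by auto
  then show thesis using that[OF g(1)] by auto
qed

lemma submodule_Proj_subspace:
  assumes "submodule V (Proj e i)"
  shows "subspace V"
proof -
  have "scale c x \<in> V" if "x \<in> V" for c x
    using assms that unfolding submodule_iff[OF lmodule_Proj] act_Proj by (metis scale_one(1))
  then show ?thesis
    using assms unfolding subspace_def submodule_iff[OF lmodule_Proj] by auto
qed

text \<open>Submodules are subspaces, since the scalar c acts as the algebra element
  \<open>scale c 1\<close>; dimension is then the required rank.\<close>

lemma finite_length_Proj:
  fixes e :: "nat \<Rightarrow> 'a"
  shows "finite_length (Proj e i)"
proof -
  obtain B where "finite B" "span B = UNIV" using finite_dim by blast
  moreover obtain B' where "B' \<subseteq> B" "independent B'" "B \<subseteq> span B'"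
    using maximal_independent_subset by blast
  ultimately have "finite B'" "independent B'" "span B' = UNIV"
    using finite_subset span_minimal[of B "span B'"] by auto
  then interpret finite_dimensional_vector_space scale B' by unfold_locales
  have "dim V < dim W" if "submodule V (Proj e i)" "submodule W (Proj e i)" "V \<subset> W" for V W
    using dim_psubset[of V W] span_eq_iff that submodule_Proj_subspace by metis
  then show ?thesis unfolding finite_length_def by blast
qed

lemma lmodule_Inj: "lmodule (Inj scale e i)"
  unfolding lmodule_def Inj_def linear_functional_iff
  by (simp add: fun_eq_iff algebra_simps) (simp add: scale_mult_left flip: mult.assoc)

end

section \<open>Generators, relations and weights of standard and costandard modules\<close>

locale quasi_hereditary_algebra = fd_algebra scale
  for scale :: "'k::alg_closed_field \<Rightarrow> 'a::ring_1 \<Rightarrow> 'a" +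
  fixes n :: nat and e :: "nat \<Rightarrow> 'a"
    and Delta :: "nat \<Rightarrow> ('a, 'd::ab_group_add) lmod"
    and Nabla :: "nat \<Rightarrow> ('a, 'c::ab_group_add) lmod"
  assumes basic: "basic_algebra n e"
    and standard: "\<forall>i\<in>{1..n}. standard_module n e i (Delta i)"
    and costandard: "\<forall>i\<in>{1..n}. costandard_module scale n e i (Nabla i)"
    and quasi_hereditary: "quasi_hereditary scale n e Delta"
begin

lemma idem: "i \<in> {1..n} \<Longrightarrow> e i * e i = e i"
  using basic by (auto simp: basic_algebra_def primitive_idempotent_def)

lemma idem_mult: "i \<in> {1..n} \<Longrightarrow> e i * (e i * a) = e i * a" "i \<in> {1..n} \<Longrightarrow> a * e i * e i = a * e i"
  by (simp_all add: idem mult.assoc) (simp add: idem flip: mult.assoc)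

lemma car_Proj: "i \<in> {1..n} \<Longrightarrow> a \<in> car (Proj e i) \<longleftrightarrow> a * e i = a"
  unfolding Proj_def using idem_mult(2)[of i] by (auto, metis)

text \<open>Right multiplication by \<open>a * e i\<close> is a homomorphism from P(m) to P(i), and
  this element is its value at \<open>e m\<close>.\<close>

lemma upper_trace_mem:
  assumes i: "i \<in> {1..n}" and m: "m \<in> {i<..n}"
  shows "e m * a * e i \<in> upper_trace n e i"
  unfolding upper_trace_def
proof (rule InterI, clarify)
  fix U assume U: "\<forall>j\<in>{i<..n}. \<forall>f\<in>Hom (Proj e j) (Proj e i). f ` car (Proj e j) \<subseteq> U"
  have mn: "m \<in> {1..n}" using i m by auto
  define f where "f x = (if x \<in> car (Proj e m) then x * a * e i else 0)" for x
  have "f \<in> Hom (Proj e m) (Proj e i)"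
    by (rule HomI)
      (auto simp: f_def car_Proj[OF i] car_Proj[OF mn] idem[OF i] algebra_simps)
  then have "f (e m) \<in> U" using U m mn idem[OF mn] car_Proj[OF mn] by blast
  then show "e m * a * e i \<in> U" by (simp add: f_def car_Proj[OF mn] idem[OF mn])
qed

text \<open>A homomorphism from P(m) to P(i) is determined by the image of \<open>e m\<close>, which
  lies in e_m A e_i. So the trace is generated by these elements, and a property of the trace can be
  tested on them.\<close>

lemma upper_trace_least:
  assumes i: "i \<in> {1..n}" and U: "submodule U (Proj e i)"
    and gen: "\<And>m a. m \<in> {i<..n} \<Longrightarrow> e m * a * e i \<in> U"
  shows "upper_trace n e i \<subseteq> U"
proof -
  have "f x \<in> U" if m: "m \<in> {i<..n}" and f: "f \<in> Hom (Proj e m) (Proj e i)"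
    and x: "x \<in> car (Proj e m)" for m f x
  proof -
    have mn: "m \<in> {1..n}" using i m by auto
    have em: "e m \<in> car (Proj e m)" by (simp add: car_Proj[OF mn] idem[OF mn])
    have hom: "f (a * e m) = a * f (e m)" for a
      using HomD(4)[OF f em, of a] by simp
    have "f (e m) = e m * f (e m) * e i"
      using hom[of "e m"] idem[OF mn] HomD(1)[OF f em] by (simp add: car_Proj[OF i] mult.assoc)
    then have "f (e m) \<in> U" using gen[OF m] by metis
    then have "x * f (e m) \<in> U" using U by (simp add: submodule_iff[OF lmodule_Proj])
    then show ?thesis using hom[of x] x by (simp add: car_Proj[OF mn])
  qed
  then show ?thesis unfolding upper_trace_def using U by (intro Inter_lower) auto
qed

lemma upper_traceD:
  assumes "i \<in> {1..n}" "a \<in> upper_trace n e i"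
  shows "a * e i = a"
  using assms submodule_subset[OF submodule_upper_trace] car_Proj by blast

text \<open>The elements of P(i) annihilating \<open>x\<close> form a submodule that contains the
  generators of the trace. Thus a vector in a module without weights above i obeys the relations of
  the generator of \<Delta>(i).\<close>

lemma upper_trace_act_eq_zero:
  assumes i: "i \<in> {1..n}" and M: "lmodule M" and x: "x \<in> car M"
    and high: "\<And>m y. m \<in> {i<..n} \<Longrightarrow> y \<in> car M \<Longrightarrow> act M (e m) y = 0"
    and a: "a \<in> upper_trace n e i"
  shows "act M a x = 0"
proof -
  have "submodule {a \<in> car (Proj e i). act M a x = 0} (Proj e i)"
    unfolding submodule_iff[OF lmodule_Proj] using x lmoduleD[OF lmodule_Proj[of e i]]
    by (auto simp: lmoduleD[OF M] lmodule_act_zero[OF M])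
  then have "upper_trace n e i \<subseteq> {a \<in> car (Proj e i). act M a x = 0}"
    by (rule upper_trace_least[OF i])
      (auto simp: car_Proj[OF i] idem[OF i] lmoduleD[OF M] x high mult.assoc)
  then show ?thesis using a by blast
qed

lemma lmodule_Delta: "i \<in> {1..n} \<Longrightarrow> lmodule (Delta i)"
  and lmodule_Nabla: "i \<in> {1..n} \<Longrightarrow> lmodule (Nabla i)"
  using standard costandard by (auto simp: standard_module_def costandard_module_def)

lemma finite_length_Delta:
  assumes "i \<in> {1..n}"
  shows "finite_length (Delta i)"
proof -
  obtain p where "p \<in> Hom (Proj e i) (Delta i)" "p ` car (Proj e i) = car (Delta i)"
    using standard assms unfolding standard_module_def quotient_iso_def by blast
  then show ?thesis
    using finite_length_image[OF lmodule_Proj lmodule_Delta[OF assms]] finite_length_Proj by blast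
qed

text \<open>The image of \<open>e i\<close> under some epimorphism from P(i) to \<Delta>(i); a
  choice is needed because standardness only asserts that such an epimorphism exists. The
  annihilator condition is the presentation of \<Delta>(i) as P(i) modulo the upper trace.\<close>

definition gen :: "nat \<Rightarrow> 'd" where
  "gen i = (SOME d. d \<in> car (Delta i) \<and> act (Delta i) (e i) d = d \<and>
     car (Delta i) = range (\<lambda>a. act (Delta i) a d) \<and>
     (\<forall>a. act (Delta i) a d = 0 \<longleftrightarrow> a * e i \<in> upper_trace n e i))"

lemma
  assumes i: "i \<in> {1..n}"
  shows gen_car: "gen i \<in> car (Delta i)"
    and gen_fixed: "act (Delta i) (e i) (gen i) = gen i"
    and gen_generates: "car (Delta i) = range (\<lambda>a. act (Delta i) a (gen i))"
    and gen_annihilator: "act (Delta i) a (gen i) = 0 \<longleftrightarrow> a * e i \<in> upper_trace n e i"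
proof -
  obtain p where p: "p \<in> Hom (Proj e i) (Delta i)" "p ` car (Proj e i) = car (Delta i)"
    and ker: "{x \<in> car (Proj e i). p x = 0} = upper_trace n e i"
    using standard i unfolding standard_module_def quotient_iso_def by blast
  have ei: "e i \<in> car (Proj e i)" by (simp add: car_Proj[OF i] idem[OF i])
  have act: "act (Delta i) a (p (e i)) = p (a * e i)" for a
    using HomD(4)[OF p(1) ei, of a] by (simp add: Proj_def)
  have ae: "a * e i \<in> car (Proj e i)" for a by (simp add: car_Proj[OF i] idem_mult[OF i])
  have "p (e i) \<in> car (Delta i) \<and> act (Delta i) (e i) (p (e i)) = p (e i) \<and>
     car (Delta i) = range (\<lambda>a. act (Delta i) a (p (e i))) \<and>
     (\<forall>a. act (Delta i) a (p (e i)) = 0 \<longleftrightarrow> a * e i \<in> upper_trace n e i)"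
  proof (intro conjI allI)
    show "p (e i) \<in> car (Delta i)" using ei p by blast
    show "act (Delta i) (e i) (p (e i)) = p (e i)" by (simp add: act idem[OF i])
    show "car (Delta i) = range (\<lambda>a. act (Delta i) a (p (e i)))"
      unfolding act p(2)[symmetric] by (auto simp: Proj_def)
    show "act (Delta i) a (p (e i)) = 0 \<longleftrightarrow> a * e i \<in> upper_trace n e i" for a
      using ae unfolding act ker[symmetric] by simp
  qed
  from someI[of "\<lambda>d. d \<in> car (Delta i) \<and> act (Delta i) (e i) d = d \<and>
     car (Delta i) = range (\<lambda>a. act (Delta i) a d) \<and>
     (\<forall>a. act (Delta i) a d = 0 \<longleftrightarrow> a * e i \<in> upper_trace n e i)", OF this]
  show "gen i \<in> car (Delta i)" "act (Delta i) (e i) (gen i) = gen i"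
    "car (Delta i) = range (\<lambda>a. act (Delta i) a (gen i))"
    "act (Delta i) a (gen i) = 0 \<longleftrightarrow> a * e i \<in> upper_trace n e i"
    unfolding gen_def by blast+
qed

text \<open>Moving \<open>e m\<close> past the generator produces an element e_m a e_i of the trace.
  In terms of composition factors, \<Delta>(i) has only labels up to i.\<close>

lemma idem_high_Delta:
  assumes i: "i \<in> {1..n}" and m: "m \<in> {i<..n}" and y: "y \<in> car (Delta i)"
  shows "act (Delta i) (e m) y = 0"
proof -
  obtain a where a: "y = act (Delta i) a (gen i)" using y gen_generates[OF i] by blast
  have "act (Delta i) (e m * a) (gen i) = 0"
    unfolding gen_annihilator[OF i] by (rule upper_trace_mem[OF i m])
  then show ?thesis using a by (simp add: act_mult[OF lmodule_Delta[OF i] gen_car[OF i]])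
qed

lemma Hom_Delta_eq_zero:
  assumes i: "i \<in> {1..n}" and f: "f \<in> Hom (Delta i) M" and "f (gen i) = 0" and M: "lmodule M"
  shows "f = 0"
proof
  fix x
  show "f x = 0 x"
  proof (cases "x \<in> car (Delta i)")
    case True
    then obtain a where "x = act (Delta i) a (gen i)" using gen_generates[OF i] by blast
    then show ?thesis using HomD(4)[OF f gen_car[OF i]] assms act_zero_right[OF M] by simp
  qed (simp add: HomD(2)[OF f])
qed

lemma lower_kernel_iff:
  assumes j: "j \<in> {1..n}"
  shows "\<xi> \<in> lower_kernel scale n e j \<longleftrightarrow>
    \<xi> \<in> car (Inj scale e j) \<and> (\<forall>m\<in>{j<..n}. \<forall>x y. \<xi> (x * e m * y) = 0)"
proof
  assume \<xi>: "\<xi> \<in> lower_kernel scale n e j"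
  have \<xi>I: "\<xi> \<in> car (Inj scale e j)" using \<xi> by (simp add: lower_kernel_def)
  have "\<xi> (x * e m * y) = 0" if m: "m \<in> {j<..n}" for m x y
  proof -
    have mn: "m \<in> {1..n}" using j m by auto
    \<comment> \<open>These maps from I(j) to I(m) are dual to multiplication by x e_m between
      projectives.\<close>
    define f where "f \<eta> = (if \<eta> \<in> car (Inj scale e j) then (\<lambda>y. \<eta> (x * e m * y)) else 0)" for \<eta>
    have "f \<in> Hom (Inj scale e j) (Inj scale e m)"
    proof (rule HomI)
      show "f \<eta> \<in> car (Inj scale e m)" if "\<eta> \<in> car (Inj scale e j)" for \<eta>
        using that unfolding f_def
        by (simp add: Inj_def linear_functional_iff algebra_simps idem_mult[OF mn] scale_mult_right)
      show "f (\<eta> + \<zeta>) = f \<eta> + f \<zeta>"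
        if "\<eta> \<in> car (Inj scale e j)" "\<zeta> \<in> car (Inj scale e j)" for \<eta> \<zeta>
        using that lmodule_add[OF lmodule_Inj that] by (auto simp: f_def fun_eq_iff)
      show "f (act (Inj scale e j) a \<eta>) = act (Inj scale e m) a (f \<eta>)"
        if "\<eta> \<in> car (Inj scale e j)" for a \<eta>
        using that lmodule_act[OF lmodule_Inj that, of a] by (auto simp: f_def Inj_def mult.assoc)
    qed (simp add: f_def)
    then have "f \<xi> = 0" using \<xi> m by (auto simp: lower_kernel_def)
    then show ?thesis using \<xi>I by (simp add: f_def fun_eq_iff)
  qed
  with \<xi>I show "\<xi> \<in> car (Inj scale e j) \<and> (\<forall>m\<in>{j<..n}. \<forall>x y. \<xi> (x * e m * y) = 0)" by blast
next
  assume \<xi>: "\<xi> \<in> car (Inj scale e j) \<and> (\<forall>m\<in>{j<..n}. \<forall>x y. \<xi> (x * e m * y) = 0)"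
  have "f \<xi> = 0" if m: "m \<in> {j<..n}" and f: "f \<in> Hom (Inj scale e j) (Inj scale e m)" for m f
  proof
    fix x
    \<comment> \<open>A functional in I(m) is recovered by acting with e_m x and evaluating at 1.
      Linearity of \<open>f\<close> moves this action to \<xi>, which it kills.\<close>
    have "f \<xi> x = f \<xi> (e m * x)"
      using HomD(1)[OF f, of \<xi>] \<xi> by (simp add: Inj_def)
    also have "\<dots> = act (Inj scale e m) (e m * x) (f \<xi>) 1" by (simp add: Inj_def)
    also have "\<dots> = f (act (Inj scale e j) (e m * x) \<xi>) 1" using HomD(4)[OF f, of \<xi>] \<xi> by simp
    also have "act (Inj scale e j) (e m * x) \<xi> = 0"
      using \<xi> m by (auto simp: Inj_def fun_eq_iff simp flip: mult.assoc)
    also have "f 0 1 = 0" by (simp add: Hom_zero[OF f lmodule_Inj])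
    finally show "f \<xi> x = 0 x" by simp
  qed
  with \<xi> show "\<xi> \<in> lower_kernel scale n e j" unfolding lower_kernel_def by blast
qed

text \<open>\<open>Nabla j\<close> is only given up to isomorphism. In this model elements can be
  evaluated, and the value at a is the value at 1 after acting with a.\<close>

definition costd :: "nat \<Rightarrow> ('a, 'a \<Rightarrow> 'k) lmod" where
  "costd j = (Inj scale e j)\<lparr>car := lower_kernel scale n e j\<rparr>"

lemma submodule_lower_kernel:
  assumes j: "j \<in> {1..n}"
  shows "submodule (lower_kernel scale n e j) (Inj scale e j)"
  unfolding submodule_iff[OF lmodule_Inj] using lmoduleD[OF lmodule_Inj[of e j]]
  by (auto simp: lower_kernel_iff[OF j]) (simp add: Inj_def mult.assoc)

lemma lmodule_costd: "j \<in> {1..n} \<Longrightarrow> lmodule (costd j)"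
  unfolding costd_def by (rule submodule_lmodule[OF submodule_lower_kernel])

lemma costd_iff:
  assumes j: "j \<in> {1..n}"
  shows "\<xi> \<in> car (costd j) \<longleftrightarrow> Vector_Spaces.linear scale (*) \<xi> \<and> (\<forall>x. \<xi> (e j * x) = \<xi> x) \<and>
    (\<forall>m\<in>{j<..n}. \<forall>x y. \<xi> (x * e m * y) = 0)"
  unfolding costd_def using lower_kernel_iff[OF j, of \<xi>] by (simp add: Inj_def)

lemma act_costd: "act (costd j) a \<xi> = (\<lambda>x. \<xi> (x * a))"
  by (simp add: costd_def Inj_def)

lemma idem_high_costd:
  assumes j: "j \<in> {1..n}" and m: "m \<in> {j<..n}" and y: "y \<in> car (costd j)"
  shows "act (costd j) (e m) y = 0"
proof
  fix x
  have "y (x * e m * 1) = 0" using y m costd_iff[OF j] by blast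
  then show "act (costd j) (e m) y x = 0 x" by (simp add: act_costd)
qed

lemma Nabla_iso:
  assumes "j \<in> {1..n}"
  obtains \<iota> where "\<iota> \<in> Hom (Nabla j) (costd j)" "bij_betw \<iota> (car (Nabla j)) (car (costd j))"
  using costandard assms unfolding costandard_module_def isomorphic_def costd_def by blast

lemma idem_high_Nabla:
  assumes j: "j \<in> {1..n}" and m: "m \<in> {j<..n}" and y: "y \<in> car (Nabla j)"
  shows "act (Nabla j) (e m) y = 0"
proof -
  note N = lmodule_Nabla[OF j]
  obtain \<iota> where \<iota>: "\<iota> \<in> Hom (Nabla j) (costd j)" "bij_betw \<iota> (car (Nabla j)) (car (costd j))"
    using Nabla_iso[OF j] .
  have "\<iota> (act (Nabla j) (e m) y) = \<iota> 0"
    using HomD(1,4)[OF \<iota>(1) y] idem_high_costd[OF j m] Hom_zero[OF \<iota>(1) N] by simp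
  then show ?thesis
    using \<iota>(2) lmoduleD(1,4)[OF N] y by (auto simp: bij_betw_def dest: inj_onD)
qed

subsection \<open>Extensions of standard by costandard modules\<close>

text \<open>
  This says that the first extension group of \<open>\<Delta>(i)\<close> by \<open>T\<close> vanishes, read off from the
  presentation of \<open>\<Delta>(i)\<close> as \<open>P(i)\<close> modulo the upper trace.
\<close>

definition ext_vanishing :: "nat \<Rightarrow> ('a, 'm::ab_group_add) lmod \<Rightarrow> bool" where
  "ext_vanishing i T \<longleftrightarrow>
     (\<forall>h\<in>Hom ((Proj e i)\<lparr>car := upper_trace n e i\<rparr>) T.
        \<exists>t\<in>car T. \<forall>a\<in>upper_trace n e i. h a = act T a t)"

lemma lmodule_upper_trace: "lmodule ((Proj e i)\<lparr>car := upper_trace n e i\<rparr>)"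
  by (rule submodule_lmodule[OF submodule_upper_trace])

text \<open>If j < i, the generators of the trace have weights above j, which \<nabla>(j) lacks, so
  \<open>h\<close> vanishes. If j \<ge> i, the injectivity of I(j) yields an element inducing
  \<open>h\<close>, and this element already lies in \<nabla>(j): the labels m > j exceed i, so the
  values to be killed are values of \<open>h\<close> on the trace.\<close>

lemma ext_vanishing_costd:
  assumes i: "i \<in> {1..n}" and j: "j \<in> {1..n}"
  shows "ext_vanishing i (costd j)"
  unfolding ext_vanishing_def
proof
  let ?K = "upper_trace n e i"
  fix h assume h: "h \<in> Hom ((Proj e i)\<lparr>car := ?K\<rparr>) (costd j)"
  have K: "submodule ?K (Proj e i)" by (rule submodule_upper_trace)
  note Kcl = K[unfolded submodule_iff[OF lmodule_Proj] act_Proj]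
  have hcar: "h a \<in> car (costd j)" if "a \<in> ?K" for a using HomD(1)[OF h] that by simp
  have hact: "h (b * a) = act (costd j) b (h a)" if "a \<in> ?K" for a b
    using HomD(4)[OF h, of a b] that by simp
  have hadd: "h (a + b) = h a + h b" if "a \<in> ?K" "b \<in> ?K" for a b
    using HomD(3)[OF h, of a b] that by simp
  have high: "h (e m * a * e i) = 0" if m: "m \<in> {i<..n}" "m \<in> {j<..n}" for m a
  proof -
    have mn: "m \<in> {1..n}" using m i by auto
    have "h (e m * (e m * a * e i)) = 0"
      using hact[OF upper_trace_mem[OF i m(1)]] idem_high_costd[OF j m(2)]
        hcar[OF upper_trace_mem[OF i m(1)]] by simp
    then show ?thesis by (simp add: mult.assoc idem_mult[OF mn])
  qed
  show "\<exists>t\<in>car (costd j). \<forall>a\<in>?K. h a = act (costd j) a t"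
  proof (cases "j < i")
    case True
    have "submodule {a \<in> ?K. h a = 0} (Proj e i)"
      unfolding submodule_iff[OF lmodule_Proj] act_Proj
      using Kcl Hom_zero[OF h lmodule_upper_trace]
      by (simp add: subset_eq hadd hact act_zero_right[OF lmodule_costd[OF j]])
    then have "?K \<subseteq> {a \<in> ?K. h a = 0}"
      by (rule upper_trace_least[OF i]) (use True high upper_trace_mem[OF i] in simp)
    then have "h a = act (costd j) a 0" if "a \<in> ?K" for a
      using that act_zero_right[OF lmodule_costd[OF j], of a] by auto
    then show ?thesis using lmodule_zero[OF lmodule_costd[OF j]] by blast
  next
    case False
    obtain \<Lambda> where \<Lambda>: "Vector_Spaces.linear scale (*) \<Lambda>" "\<And>a. a \<in> ?K \<Longrightarrow> \<Lambda> a = h a 1"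
    proof (rule linear_functional_extend[of ?K "\<lambda>a. h a 1"])
      show "subspace ?K" by (rule submodule_Proj_subspace[OF K])
      show "h (a + b) 1 = h a 1 + h b 1" if "a \<in> ?K" "b \<in> ?K" for a b
        using hadd[OF that] by simp
      show "h (scale c a) 1 = c * h a 1" if a: "a \<in> ?K" for c a
      proof -
        have "h (scale c a) 1 = h a (scale c 1)"
          using hact[OF a, of "scale c 1"] by (simp add: act_costd)
        then show ?thesis
          using hcar[OF a] by (simp add: costd_iff[OF j] linear_functional_iff)
      qed
    qed blast
    \<comment> \<open>Cutting with e_j on the left puts \<xi> into D(e_j A). Cutting with e_i on the
      right sends products through e_m, m > j, into the trace, where \<Lambda> is known from
      \<open>h\<close>.\<close>
    define \<xi> where "\<xi> x = \<Lambda> (e j * x * e i)" for x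
    have val: "h a x = \<Lambda> (e j * x * a)" if a: "a \<in> ?K" for a x
    proof -
      have "h a x = h a (e j * x)" using hcar[OF a] by (simp add: costd_iff[OF j])
      also have "\<dots> = h (e j * x * a) 1" using hact[OF a] by (simp add: act_costd)
      also have "\<dots> = \<Lambda> (e j * x * a)" using \<Lambda>(2) Kcl a by metis
      finally show ?thesis .
    qed
    have "\<xi> (x * e m * y) = 0" if m: "m \<in> {j<..n}" for m x y
    proof -
      have mi: "m \<in> {i<..n}" using m False by auto
      have "\<xi> (x * e m * y) = h (e m * y * e i) x"
        using val[OF upper_trace_mem[OF i mi]] by (simp add: \<xi>_def mult.assoc)
      then show ?thesis by (simp add: high[OF mi m])
    qed
    then have "\<xi> \<in> car (costd j)"
      using \<Lambda>(1) unfolding costd_iff[OF j] linear_functional_iff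
      by (simp add: \<xi>_def algebra_simps idem_mult[OF j] scale_mult_left scale_mult_right)
    moreover have "h a = act (costd j) a \<xi>" if "a \<in> ?K" for a
      using val[OF that] upper_traceD[OF i that]
      by (auto simp: act_costd \<xi>_def mult.assoc)
    ultimately show ?thesis by blast
  qed
qed

lemma ext_vanishing_Nabla:
  assumes i: "i \<in> {1..n}" and j: "j \<in> {1..n}"
  shows "ext_vanishing i (Nabla j)"
  unfolding ext_vanishing_def
proof
  fix h assume h: "h \<in> Hom ((Proj e i)\<lparr>car := upper_trace n e i\<rparr>) (Nabla j)"
  obtain \<iota> where \<iota>: "\<iota> \<in> Hom (Nabla j) (costd j)" "bij_betw \<iota> (car (Nabla j)) (car (costd j))"
    using Nabla_iso[OF j] .
  have "\<iota> \<circ> h \<in> Hom ((Proj e i)\<lparr>car := upper_trace n e i\<rparr>) (costd j)"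
    by (rule Hom_comp[OF h \<iota>(1) lmodule_Nabla[OF j]])
  then obtain u where u: "u \<in> car (costd j)"
    "\<And>a. a \<in> upper_trace n e i \<Longrightarrow> \<iota> (h a) = act (costd j) a u"
    using ext_vanishing_costd[OF i j] unfolding ext_vanishing_def by fastforce
  obtain t where t: "t \<in> car (Nabla j)" "u = \<iota> t"
    using \<iota>(2) u(1) by (auto simp: bij_betw_def)
  have "h a = act (Nabla j) a t" if a: "a \<in> upper_trace n e i" for a
  proof (rule inj_onD[OF bij_betw_imp_inj_on[OF \<iota>(2)]])
    show "\<iota> (h a) = \<iota> (act (Nabla j) a t)" using u(2)[OF a] t HomD(4)[OF \<iota>(1)] by simp
    show "h a \<in> car (Nabla j)" using HomD(1)[OF h] a by simp
    show "act (Nabla j) a t \<in> car (Nabla j)" using lmodule_act[OF lmodule_Nabla[OF j]] t by simp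
  qed
  then show "\<exists>t\<in>car (Nabla j). \<forall>a\<in>upper_trace n e i. h a = act (Nabla j) a t" using t by blast
qed

text \<open>The middle term of a long exact sequence, done by hand: a solution in \<open>X\<close>
  lifts to \<open>t0\<close>, the error of \<open>h\<close> against \<open>t0\<close> takes values
  in the kernel \<open>V\<close>, and a solution \<open>t1\<close> there corrects it.\<close>

lemma ext_vanishing_extension:
  assumes M: "lmodule M" and V: "submodule V M" and X: "lmodule X" and q: "quotient_iso M V X"
    and extX: "ext_vanishing i X" and extV: "ext_vanishing i (M\<lparr>car := V\<rparr>)"
  shows "ext_vanishing i M"
  unfolding ext_vanishing_def
proof
  let ?K = "(Proj e i)\<lparr>car := upper_trace n e i\<rparr>"
  fix h assume h: "h \<in> Hom ?K M"
  obtain p where p: "p \<in> Hom M X" "p ` car M = car X" and ker: "{x \<in> car M. p x = 0} = V"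
    using q unfolding quotient_iso_def by blast
  obtain u where u: "u \<in> car X" "\<And>a. a \<in> upper_trace n e i \<Longrightarrow> p (h a) = act X a u"
    using extX Hom_comp[OF h p(1) M] unfolding ext_vanishing_def by fastforce
  obtain t0 where t0: "t0 \<in> car M" "u = p t0" using u(1) p(2) by blast
  define h' where "h' a = (if a \<in> car ?K then h a - act M a t0 else 0)" for a
  have Kadd: "a + b \<in> upper_trace n e i" if "a \<in> upper_trace n e i" "b \<in> upper_trace n e i" for a b
    using lmodule_add[OF lmodule_upper_trace, of a i b] that by simp
  have Kact: "b * a \<in> upper_trace n e i" if "a \<in> upper_trace n e i" for a b
    using lmodule_act[OF lmodule_upper_trace, of a i b] that by simp
  have hcar: "h a \<in> car M" if "a \<in> upper_trace n e i" for a
    using HomD(1)[OF h, of a] that by simp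
  have "h' \<in> Hom ?K (M\<lparr>car := V\<rparr>)"
  proof (rule HomI)
    show "h' a \<in> car (M\<lparr>car := V\<rparr>)" if "a \<in> car ?K" for a
      using that u(2)[of a] hcar[of a] t0 Hom_diff[OF p(1) M, of "h a" "act M a t0"]
        HomD(4)[OF p(1), of t0 a] lmodule_act[OF M t0(1), of a]
        lmodule_minus[OF M, of "h a" "act M a t0"]
      by (simp add: h'_def flip: ker)
    show "h' (a + b) = h' a + h' b" if "a \<in> car ?K" "b \<in> car ?K" for a b
      using that HomD(3)[OF h that] Kadd[of a b] by (simp add: h'_def act_add_left[OF M t0(1)])
    show "h' (act ?K b a) = act (M\<lparr>car := V\<rparr>) b (h' a)" if "a \<in> car ?K" for a b
      using that HomD(4)[OF h that, of b] Kact[of a b] hcar[of a] lmodule_act[OF M t0(1), of a]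
      by (simp add: h'_def act_mult[OF M t0(1)] act_diff_right[OF M])
  qed (simp add: h'_def)
  then obtain t1 where t1: "t1 \<in> V" "\<And>a. a \<in> upper_trace n e i \<Longrightarrow> h' a = act M a t1"
    using extV unfolding ext_vanishing_def by fastforce
  have t1M: "t1 \<in> car M" using t1(1) V by (auto simp: submodule_def)
  have "h a = act M a (t0 + t1)" if "a \<in> upper_trace n e i" for a
    using t1(2)[OF that] that by (simp add: h'_def act_add_right[OF M t0(1) t1M] algebra_simps)
  then show "\<exists>t\<in>car M. \<forall>a\<in>upper_trace n e i. h a = act M a t"
    using lmodule_add[OF M t0(1) t1M] by blast
qed

lemma ext_vanishing_filtered:
  assumes M: "lmodule M" and filt: "filtered (Nabla ` {1..n}) M" and i: "i \<in> {1..n}"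
  shows "ext_vanishing i M"
proof -
  have "ext_vanishing i (M\<lparr>car := car M\<rparr>)"
  proof (rule filtered_induct[OF filt M, where P = "\<lambda>U. ext_vanishing i (M\<lparr>car := U\<rparr>)"])
    show "ext_vanishing i (M\<lparr>car := {0}\<rparr>)"
      unfolding ext_vanishing_def using HomD(1) by (fastforce simp: act_zero_right[OF M])
    fix U U' X
    assume "submodule U M" "submodule U' M" "U \<subseteq> U'" "X \<in> Nabla ` {1..n}"
      "quotient_iso (M\<lparr>car := U'\<rparr>) U X" "ext_vanishing i (M\<lparr>car := U\<rparr>)"
    then show "ext_vanishing i (M\<lparr>car := U'\<rparr>)"
      using lmodule_Nabla ext_vanishing_Nabla[OF i] submodule_restrict[of U M U']
      by (intro ext_vanishing_extension[OF submodule_lmodule[of U' M], of U X]) auto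
  qed
  then show ?thesis by simp
qed

section \<open>Building homomorphisms along a standard filtration\<close>

lemma Hom_Nabla_eq_zero:
  assumes i: "i \<in> {1..n}" and m: "m \<in> {i<..n}"
    and \<tau>: "\<tau> \<in> Hom M (Nabla i)" and M: "lmodule M" and x: "x \<in> car M"
  shows "\<tau> (act M (b * e m) x) = 0"
  using HomD(1,4)[OF \<tau>] x idem_high_Nabla[OF i m] lmodule_act[OF M]
  by (simp add: act_mult[OF M x] act_zero_right[OF lmodule_Nabla[OF i]])

text \<open>Any preimage of \<open>gen i\<close> becomes a weight vector after multiplication by
  \<open>e i\<close>, without changing its image. Its relations modulo \<open>U\<close> are those of
  \<open>gen i\<close>, which is the input required by \<open>glue_cyclic\<close>.\<close>

lemma lift_generator:
  assumes i: "i \<in> {1..n}" and U': "submodule U' M"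
    and quot: "quotient_iso (M\<lparr>car := U'\<rparr>) U (Delta i)"
  obtains q z where "q \<in> Hom (M\<lparr>car := U'\<rparr>) (Delta i)" "\<And>x. x \<in> U' \<Longrightarrow> q x = 0 \<longleftrightarrow> x \<in> U"
    "z \<in> U'" "act M (e i) z = z" "q z = gen i" "\<And>x. x \<in> U' \<Longrightarrow> \<exists>a. x - act M a z \<in> U"
    "\<And>a. act M a z \<in> U \<Longrightarrow> a * e i \<in> upper_trace n e i"
proof -
  note L = submodule_lmodule[OF U'] and D = lmodule_Delta[OF i]
  obtain q where q: "q \<in> Hom (M\<lparr>car := U'\<rparr>) (Delta i)" "q ` U' = car (Delta i)"
    and ker: "{x \<in> U'. q x = 0} = U"
    using quot unfolding quotient_iso_def by auto
  have qact: "q (act M a x) = act (Delta i) a (q x)" if "x \<in> U'" for a x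
    using HomD(4)[OF q(1), of x a] that by simp
  have Uact: "act M a x \<in> U'" if "x \<in> U'" for a x
    using lmodule_act[OF L, of x a] that by simp
  have Umult: "act M (a * b) x = act M a (act M b x)" if "x \<in> U'" for a b x
    using act_mult[OF L, of x a b] that by simp
  have Udiff: "x - y \<in> U'" "q (x - y) = q x - q y" if "x \<in> U'" "y \<in> U'" for x y
    using lmodule_minus[OF L, of x y] Hom_diff[OF q(1) L, of x y] that by simp_all
  obtain z0 where z0: "z0 \<in> U'" "q z0 = gen i" using q(2) gen_car[OF i] by (metis imageE)
  define z where "z = act M (e i) z0"
  have z: "z \<in> U'" "act M (e i) z = z" "q z = gen i"
    using z0 Uact Umult[symmetric] idem[OF i] gen_fixed[OF i] by (simp_all add: z_def qact)
  show thesis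
  proof (rule that[OF q(1) _ z])
    show "q x = 0 \<longleftrightarrow> x \<in> U" if "x \<in> U'" for x using ker that by blast
    show "\<exists>a. x - act M a z \<in> U" if x: "x \<in> U'" for x
    proof -
      have "q x \<in> car (Delta i)" using q(2) x by blast
      then obtain a where "q x = act (Delta i) a (gen i)"
        unfolding gen_generates[OF i] by blast
      then have "q (x - act M a z) = 0"
        using x z Uact by (simp add: Udiff qact)
      then show ?thesis using ker Udiff(1)[OF x Uact[OF z(1)]] by blast
    qed
    show "a * e i \<in> upper_trace n e i" if "act M a z \<in> U" for a
    proof -
      have "q (act M a z) = 0" using that ker by blast
      then show ?thesis using z by (simp add: qact gen_annihilator[OF i])
    qed
  qed
qed

text \<open>The obstruction to extending \<open>f\<close> is the map a \<mapsto> f(az) on the upper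
  trace. Vanishing of extensions writes it as a \<mapsto> at, so a suitable image for
  \<open>z\<close> can be read off from \<open>t\<close>.\<close>

lemma Hom_extend:
  assumes i: "i \<in> {1..n}" and M: "lmodule M" and T: "lmodule T" and U: "submodule U M"
    and U': "submodule U' M" and sub: "U \<subseteq> U'"
    and quot: "quotient_iso (M\<lparr>car := U'\<rparr>) U (Delta i)" and ext: "ext_vanishing i T"
    and f: "f \<in> Hom (M\<lparr>car := U\<rparr>) T"
  obtains g where "g \<in> Hom (M\<lparr>car := U'\<rparr>) T" "\<And>x. x \<in> U \<Longrightarrow> g x = f x"
proof -
  obtain q z where qz: "q \<in> Hom (M\<lparr>car := U'\<rparr>) (Delta i)" "\<And>x. x \<in> U' \<Longrightarrow> q x = 0 \<longleftrightarrow> x \<in> U"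
    "z \<in> U'" "act M (e i) z = z" "q z = gen i" "\<And>x. x \<in> U' \<Longrightarrow> \<exists>a. x - act M a z \<in> U"
    "\<And>a. act M a z \<in> U \<Longrightarrow> a * e i \<in> upper_trace n e i"
    using lift_generator[OF i U' quot] by metis
  have zM: "z \<in> car M" using qz(3) U' by (auto simp: submodule_def)
  let ?K = "(Proj e i)\<lparr>car := upper_trace n e i\<rparr>"
  have aU: "act M a z \<in> U" if a: "a \<in> upper_trace n e i" for a
  proof -
    have "act M a z \<in> U'" using lmodule_act[OF submodule_lmodule[OF U'], of z a] qz(3) by simp
    moreover have "q (act M a z) = 0"
      using HomD(4)[OF qz(1), of z a] qz(3,5) gen_annihilator[OF i, of a] upper_traceD[OF i a] a
      by simp
    ultimately show ?thesis using qz(2) by simp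
  qed
  define h where "h a = (if a \<in> car ?K then f (act M a z) else 0)" for a
  have "h \<in> Hom ?K T"
  proof (rule HomI)
    show "h a \<in> car T" if "a \<in> car ?K" for a
      using that aU[of a] HomD(1)[OF f] by (simp add: h_def)
    show "h (a + b) = h a + h b" if "a \<in> car ?K" "b \<in> car ?K" for a b
      using that aU[of a] aU[of b] HomD(3)[OF f] lmodule_add[OF lmodule_upper_trace that]
      by (simp add: h_def act_add_left[OF M zM])
    show "h (act ?K b a) = act T b (h a)" if "a \<in> car ?K" for a b
      using that aU[of a] HomD(4)[OF f] lmodule_act[OF lmodule_upper_trace that, of b]
      by (simp add: h_def act_mult[OF M zM])
  qed (simp add: h_def)
  then obtain t where t: "t \<in> car T" "\<And>a. a \<in> upper_trace n e i \<Longrightarrow> h a = act T a t"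
    using ext unfolding ext_vanishing_def by metis
  \<comment> \<open>The image of \<open>z\<close> is e_i t rather than t: only
    \<open>a * e i\<close>, not \<open>a\<close> itself, is known to lie in the trace, and
    \<open>z\<close> is fixed by \<open>e i\<close>.\<close>
  have compat: "f (act M a z) = act T a (act T (e i) t)" if "act M a z \<in> U" for a
  proof -
    have K: "a * e i \<in> upper_trace n e i" by (rule qz(7)[OF that])
    have "act M a z = act M (a * e i) z" using qz(4) by (simp add: act_mult[OF M zM])
    then have "f (act M a z) = h (a * e i)" using K by (simp add: h_def)
    then show ?thesis using t(2)[OF K] by (simp add: act_mult[OF T t(1)])
  qed
  show thesis
    using glue_cyclic[OF M T U U' sub qz(3) lmodule_act[OF T t(1)] qz(6) f compat] that by metis
qed

text \<open>A vector of weight i in \<Delta>(i) obeys the relations of the generator, so sending the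
  generator to it defines an endomorphism, which is a scalar by quasi-heredity.\<close>

lemma weight_space_Delta:
  assumes i: "i \<in> {1..n}" and y: "y \<in> car (Delta i)" "act (Delta i) (e i) y = y"
  obtains c where "y = scalar scale (Delta i) c (gen i)"
proof -
  note D = lmodule_Delta[OF i]
  have y0: "act (Delta i) a y = 0" if "a \<in> upper_trace n e i" for a
    using upper_trace_act_eq_zero[OF i D y(1) idem_high_Delta[OF i] that] by simp
  obtain g where g: "g \<in> Hom ((Delta i)\<lparr>car := car (Delta i)\<rparr>) (Delta i)" "g (gen i) = y"
  proof (rule glue_cyclic[OF D D, of "{0}" "car (Delta i)" "gen i" y 0])
    show "submodule {0} (Delta i)"
      unfolding submodule_iff[OF D] by (simp add: lmoduleD[OF D] act_zero_right[OF D])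
    show "\<exists>a. v - act (Delta i) a (gen i) \<in> {0}" if "v \<in> car (Delta i)" for v
      using that gen_generates[OF i] by auto
    show "0 \<in> Hom ((Delta i)\<lparr>car := {0}\<rparr>) (Delta i)"
      by (rule HomI) (simp_all add: lmoduleD[OF D] act_zero_right[OF D])
    show "0 (act (Delta i) a (gen i)) = act (Delta i) a y"
      if "act (Delta i) a (gen i) \<in> {0}" for a
    proof -
      have "act (Delta i) (a * e i) y = 0" using that gen_annihilator[OF i] y0 by simp
      then show ?thesis using y by (simp add: act_mult[OF D])
    qed
  qed (use y gen_car[OF i] lmoduleD[OF D] submodule_car[OF D] in auto)
  then show thesis
    using that quasi_hereditary i gen_car[OF i] unfolding quasi_hereditary_def
    by (metis (no_types, lifting) lmod.surjective lmod.update_convs(1))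
qed

text \<open>
  The induction peels off the top factor \<open>\<Delta>(m)\<close> of the filtration: it contributes nothing
  visible to \<open>\<nabla>(i)\<close> if \<open>m > i\<close>, has no \<open>i\<close>-th weight space if \<open>m < i\<close>, and for \<open>m = i\<close> its
  \<open>i\<close>-th weight space is one-dimensional because its endomorphism ring is the ground field.
\<close>

lemma ex_Hom_with_prescribed_value:
  assumes i: "i \<in> {1..n}" and M: "lmodule M" and T: "lmodule T"
    and filt: "filtered (Delta ` {1..n}) M" and ext: "\<And>j. j \<in> {1..n} \<Longrightarrow> ext_vanishing j T"
    and \<sigma>: "\<sigma> \<in> Hom M (Nabla i)"
    and x: "x \<in> car T" "act T (e i) x = x" "\<And>a. a \<in> upper_trace n e i \<Longrightarrow> act T a x = 0"
    and y: "y \<in> car M" "act M (e i) y = y" "\<sigma> y \<noteq> 0"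
  shows "\<exists>\<psi>\<in>Hom M T. \<forall>\<tau>\<in>Hom T (Nabla i). \<tau> (\<psi> y) = \<tau> x"
proof -
  \<comment> \<open>The vector is quantified inside the predicate because the induction replaces
    \<open>y\<close> by another vector of the smaller submodule.\<close>
  define P where "P U \<longleftrightarrow> (\<forall>y\<in>U. act M (e i) y = y \<longrightarrow> \<sigma> y \<noteq> 0 \<longrightarrow>
    (\<exists>\<psi>\<in>Hom (M\<lparr>car := U\<rparr>) T. \<forall>\<tau>\<in>Hom T (Nabla i). \<tau> (\<psi> y) = \<tau> x))" for U
  have "P (car M)"
    using filt M
  proof (induction rule: filtered_induct)
    case zero
    show ?case by (simp add: P_def Hom_zero[OF \<sigma> M])
  next
    case (step U U' X)
    then obtain m where m: "m \<in> {1..n}" and quot: "quotient_iso (M\<lparr>car := U'\<rparr>) U (Delta m)"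
      by blast
    note U = step(1) and U' = step(2) and sub = step(3) and IH = step(6)
    have UM': "U' \<subseteq> car M" by (rule submodule_subset[OF U'])
    obtain q z where q: "q \<in> Hom (M\<lparr>car := U'\<rparr>) (Delta m)" "\<And>x. x \<in> U' \<Longrightarrow> q x = 0 \<longleftrightarrow> x \<in> U"
      and z: "z \<in> U'" "act M (e m) z = z" "q z = gen m"
      and cyc: "\<And>x. x \<in> U' \<Longrightarrow> \<exists>a. x - act M a z \<in> U"
      and ann: "\<And>a. act M a z \<in> U \<Longrightarrow> a * e m \<in> upper_trace n e m"
      using lift_generator[OF m U' quot] by metis
    have zM: "z \<in> car M" using z(1) UM' by blast
    have in_U: "\<exists>\<psi>\<in>Hom (M\<lparr>car := U'\<rparr>) T. \<forall>\<tau>\<in>Hom T (Nabla i). \<tau> (\<psi> u) = \<tau> x"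
      if u: "u \<in> U" "act M (e i) u = u" "\<sigma> u \<noteq> 0" for u
    proof -
      obtain \<psi> where \<psi>: "\<psi> \<in> Hom (M\<lparr>car := U\<rparr>) T" "\<And>\<tau>. \<tau> \<in> Hom T (Nabla i) \<Longrightarrow> \<tau> (\<psi> u) = \<tau> x"
        using IH u unfolding P_def by blast
      obtain g where "g \<in> Hom (M\<lparr>car := U'\<rparr>) T" "\<And>x. x \<in> U \<Longrightarrow> g x = \<psi> x"
        using Hom_extend[OF m M T U U' sub quot ext[OF m] \<psi>(1)] by metis
      then show ?thesis using \<psi>(2) u(1) by metis
    qed
    show ?case
      unfolding P_def
    proof (intro ballI impI)
      fix y assume y: "y \<in> U'" "act M (e i) y = y" "\<sigma> y \<noteq> 0"
      have yM: "y \<in> car M" using y(1) UM' by blast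
      have qy: "act (Delta m) (e i) (q y) = q y"
        using HomD(4)[OF q(1), of y "e i"] y(1,2) by simp
      have qyD: "q y \<in> car (Delta m)" using HomD(1)[OF q(1), of y] y(1) by simp
      consider "m > i" | "m < i" | "m = i" by linarith
      then show "\<exists>\<psi>\<in>Hom (M\<lparr>car := U'\<rparr>) T. \<forall>\<tau>\<in>Hom T (Nabla i). \<tau> (\<psi> y) = \<tau> x"
      proof cases
        case 1
        then have mi: "m \<in> {i<..n}" using m by auto
        note invisible = Hom_Nabla_eq_zero[OF i mi]
        obtain a0 where a0: "y - act M a0 z \<in> U" using cyc[OF y(1)] by blast
        \<comment> \<open>Modulo \<open>U\<close> the vector \<open>y\<close> equals a0 z. Cutting
          with \<open>e i\<close> keeps the weight of \<open>y\<close>, while the factor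
          \<open>e m\<close> in front of \<open>z\<close> makes \<open>w\<close> invisible to
          \<nabla>(i), both in \<open>M\<close> and after applying \<psi>.\<close>
        define w where "w = act M (e i * a0 * e m) z"
        define u where "u = y - w"
        have wM: "w \<in> car M" unfolding w_def by (rule lmodule_act[OF M zM])
        have wfix: "act M (e i) w = w"
          by (simp add: w_def idem_mult[OF i] mult.assoc flip: act_mult[OF M zM])
        have w_eq: "w = act M (e i) (act M a0 z)"
          using z(2) by (simp add: w_def act_mult[OF M zM] act_mult[OF M] lmodule_act[OF M zM])
        have "act M (e i) (y - act M a0 z) \<in> U"
          using lmodule_act[OF submodule_lmodule[OF U], of "y - act M a0 z" "e i"] a0 by simp
        then have uU: "u \<in> U"
          by (simp add: u_def w_eq act_diff_right[OF M yM lmodule_act[OF M zM]] y(2))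
        have ufix: "act M (e i) u = u"
          by (simp add: u_def act_diff_right[OF M yM wM] y(2) wfix)
        have "\<sigma> w = 0" unfolding w_def by (rule invisible[OF \<sigma> M zM])
        then have "\<sigma> u \<noteq> 0" using y(3) by (simp add: u_def Hom_diff[OF \<sigma> M yM wM])
        then obtain \<psi> where \<psi>: "\<psi> \<in> Hom (M\<lparr>car := U'\<rparr>) T"
          "\<And>\<tau>. \<tau> \<in> Hom T (Nabla i) \<Longrightarrow> \<tau> (\<psi> u) = \<tau> x"
          using in_U[OF uU ufix] by blast
        have zT: "\<psi> z \<in> car T" using HomD(1)[OF \<psi>(1)] z(1) by simp
        have uU': "u \<in> U'" using uU sub by blast
        have wU': "w \<in> U'" unfolding w_def
          using lmodule_act[OF submodule_lmodule[OF U'], of z] z(1) by simp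
        have "\<tau> (\<psi> y) = \<tau> x" if \<tau>: "\<tau> \<in> Hom T (Nabla i)" for \<tau>
        proof -
          have "\<psi> w = act T (e i * a0 * e m) (\<psi> z)"
            using HomD(4)[OF \<psi>(1), of z "e i * a0 * e m"] z(1) by (simp add: w_def)
          then have "\<tau> (\<psi> w) = 0" using invisible[OF \<tau> T zT] by simp
          moreover have "\<psi> y = \<psi> u + \<psi> w"
            using HomD(3)[OF \<psi>(1), of u w] uU' wU' by (simp add: u_def)
          ultimately show ?thesis
            using HomD(3)[OF \<tau>, of "\<psi> u" "\<psi> w"] HomD(1)[OF \<psi>(1)] uU' wU' \<psi>(2)[OF \<tau>] by simp
        qed
        then show ?thesis using \<psi>(1) by blast
      next
        case 2
        then have "q y = 0" using idem_high_Delta[OF m, of i "q y"] i qy qyD by simp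
        then show ?thesis using in_U[OF _ y(2,3)] q(2)[OF y(1)] by blast
      next
        case 3
        note D = lmodule_Delta[OF i]
        obtain c where c: "q y = scalar scale (Delta i) c (gen i)"
          using weight_space_Delta[OF i] qy qyD 3 by metis
        show ?thesis
        proof (cases "c = 0")
          case True
          then have "q y = 0" using c scalar_zero[OF D gen_car[OF i]] by simp
          then show ?thesis using in_U[OF _ y(2,3)] q(2)[OF y(1)] by blast
        next
          case False
          \<comment> \<open>With \<open>U\<close> sent to 0 the only condition is that
            \<open>x\<close> satisfies the relations of \<open>z\<close> modulo \<open>U\<close>,
            that is, those of \<open>gen i\<close>. The factor \<open>inverse c\<close> cancels the
            coefficient of \<open>y\<close> along \<open>z\<close>, so \<open>y\<close> is sent
            exactly to \<open>x\<close>.\<close>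
          obtain \<psi> where \<psi>: "\<psi> \<in> Hom (M\<lparr>car := U'\<rparr>) T" "\<And>x. x \<in> U \<Longrightarrow> \<psi> x = 0 x"
            "\<psi> z = scalar scale T (inverse c) x"
          proof (rule glue_cyclic[OF M T U U' sub z(1) scalar_car[OF T x(1), of "inverse c"] cyc])
            show "0 \<in> Hom (M\<lparr>car := U\<rparr>) T"
              by (rule HomI) (simp_all add: lmoduleD[OF T] act_zero_right[OF T])
            show "0 (act M a z) = act T a (scalar scale T (inverse c) x)" if "act M a z \<in> U" for a
            proof -
              have "act T a x = 0"
                using x(3)[of "a * e i"] ann[OF that] 3 act_mult[OF T x(1), of a "e i"] x(2) by simp
              then show ?thesis
                by (simp add: act_scalar[OF T x(1)]) (simp add: scalar_def act_zero_right[OF T])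
            qed
          qed blast+
          have cz: "scalar scale M c z \<in> U'"
            using lmodule_act[OF submodule_lmodule[OF U'], of z "scale c 1"] z(1)
            by (simp add: scalar_def)
          have diffU': "y - scalar scale M c z \<in> U'"
            using lmodule_minus[OF submodule_lmodule[OF U'], of y] y(1) cz by simp
          have "q (scalar scale M c z) = q y"
            using HomD(4)[OF q(1), of z "scale c 1"] z c 3 by (simp add: scalar_def)
          then have "q (y - scalar scale M c z) = 0"
            using Hom_diff[OF q(1) submodule_lmodule[OF U'], of y "scalar scale M c z"] y(1) cz by simp
          then have "y - scalar scale M c z \<in> U" using q(2)[OF diffU'] by simp
          then have "\<psi> (y - scalar scale M c z) = 0" using \<psi>(2) by simp
          then have "\<psi> y = \<psi> (scalar scale M c z)"
            using Hom_diff[OF \<psi>(1) submodule_lmodule[OF U'], of y "scalar scale M c z"] y(1) cz by simp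
          also have "\<dots> = scalar scale T c (\<psi> z)"
            using HomD(4)[OF \<psi>(1), of z "scale c 1"] z(1) by (simp add: scalar_def)
          also have "\<dots> = x"
            using False scalar_mult[OF T x(1), of c "inverse c"] scalar_one[OF T x(1)] \<psi>(3) by simp
          finally show ?thesis using \<psi>(1) by blast
        qed
      qed
    qed
  qed
  then show ?thesis using y unfolding P_def by auto
qed

text \<open>If the value were non-zero, \<phi>(x) would be a weight vector that \<sigma> sees, and a
  map \<psi> returning it to \<open>x\<close> up to invisible terms would exist. The common summand
  this produces is what \<open>minimal\<close> forbids.\<close>

lemma composite_eq_zero:
  assumes i: "i \<in> {1..n}" and M: "tilting n Delta Nabla M" and N: "tilting n Delta Nabla N"
    and \<phi>: "\<phi> \<in> Hom M N"
    and minimal: "\<not> (\<exists>X X' Y Y'. decomposes M X X' \<and> decomposes N Y Y' \<and> X \<noteq> {0} \<and>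
      bij_betw (\<lambda>x. projection Y Y' (\<phi> x)) X Y)"
    and f: "f \<in> Hom (Delta i) M" and \<sigma>: "\<sigma> \<in> Hom N (Nabla i)"
  shows "\<sigma> (\<phi> (f (gen i))) = 0"
proof (rule ccontr)
  assume nz: "\<sigma> (\<phi> (f (gen i))) \<noteq> 0"
  have lm: "lmodule M" "lmodule N" using M N by (auto simp: tilting_def)
  have fM: "filtered (Delta ` {1..n}) M" "filtered (Nabla ` {1..n}) M"
    "filtered (Delta ` {1..n}) N"
    using M N by (auto simp: tilting_def)
  have fin: "finite_length M"
    using filtered_finite_length[OF fM(1) lm(1)] lmodule_Delta finite_length_Delta by blast
  define x where "x = f (gen i)"
  have x: "x \<in> car M" "act M (e i) x = x" "\<And>a. a \<in> upper_trace n e i \<Longrightarrow> act M a x = 0"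
  proof -
    show "x \<in> car M" using HomD(1)[OF f gen_car[OF i]] by (simp add: x_def)
    show "act M (e i) x = x"
      using HomD(4)[OF f gen_car[OF i], of "e i"] gen_fixed[OF i] by (simp add: x_def)
    show "act M a x = 0" if "a \<in> upper_trace n e i" for a
      using HomD(4)[OF f gen_car[OF i], of a] gen_annihilator[OF i, of a] upper_traceD[OF i that]
        that Hom_zero[OF f lmodule_Delta[OF i]] by (simp add: x_def)
  qed
  have y: "\<phi> x \<in> car N" "act N (e i) (\<phi> x) = \<phi> x" "\<sigma> (\<phi> x) \<noteq> 0"
    using HomD(1)[OF \<phi> x(1)] HomD(4)[OF \<phi> x(1), of "e i"] x(2) nz by (simp_all add: x_def)
  obtain \<psi> where \<psi>: "\<psi> \<in> Hom N M" "\<And>\<tau>. \<tau> \<in> Hom M (Nabla i) \<Longrightarrow> \<tau> (\<psi> (\<phi> x)) = \<tau> x"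
    using ex_Hom_with_prescribed_value[OF i lm(2,1) fM(3) ext_vanishing_filtered[OF lm(1) fM(2)] \<sigma> x y]
    by blast
  have \<theta>: "\<psi> \<circ> \<phi> \<in> Hom M M" by (rule Hom_comp[OF \<phi> \<psi>(1) lm(2)])
  \<comment> \<open>The test map varies in the induction: composing it with \<psi> \<circ> \<phi>
    gives another map to \<nabla>(i). The instance \<tau> = \<sigma> \<circ> \<phi> then detects
    every power.\<close>
  have "\<tau> (((\<psi> \<circ> \<phi>) ^^ j) x) = \<tau> x" if "\<tau> \<in> Hom M (Nabla i)" for j \<tau>
    using that
  proof (induction j arbitrary: \<tau>)
    case (Suc j)
    have "\<tau> \<circ> (\<psi> \<circ> \<phi>) \<in> Hom M (Nabla i)" by (rule Hom_comp[OF \<theta> Suc.prems lm(1)])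
    from Suc.IH[OF this] show ?case using \<psi>(2)[OF Suc.prems] by simp
  qed simp
  from this[OF Hom_comp[OF \<phi> \<sigma> lm(2)]]
  have "\<sigma> (\<phi> (((\<psi> \<circ> \<phi>) ^^ j) x)) = \<sigma> (\<phi> x)" for j by simp
  then have "((\<psi> \<circ> \<phi>) ^^ j) x \<noteq> 0" for j
    using y(3) Hom_zero[OF \<phi> lm(1)] Hom_zero[OF \<sigma> lm(2)] by metis
  then show False
    using nonnilpotent_common_summand[OF lm fin \<phi> \<psi>(1) x(1)] minimal by blast
qed

end

subsection \<open>The pairing\<close>

definition single :: "nat \<Rightarrow> 'm \<Rightarrow> nat \<Rightarrow> 'm::zero" where
  "single i y = (\<lambda>j. if j = i then y else 0)"

lemma car_dsum:
  "x \<in> car (dsum n M) \<longleftrightarrow> (\<forall>i\<in>{1..n}. x i \<in> car (M i)) \<and> (\<forall>i. i \<notin> {1..n} \<longrightarrow> x i = 0)"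
  by (simp add: dsum_def)

lemma act_dsum: "act (dsum n M) a x = (\<lambda>i. if i \<in> {1..n} then act (M i) a (x i) else 0)"
  by (simp add: dsum_def)

lemma lmodule_dsum:
  assumes "\<And>i. i \<in> {1..n} \<Longrightarrow> lmodule (M i)"
  shows "lmodule (dsum n M)"
  unfolding lmodule_def Ball_def car_dsum act_dsum
  by (auto simp: fun_eq_iff lmoduleD[OF assms])

text \<open>The case distinction enforces the convention that homomorphisms vanish outside their
  source.\<close>

lemma single_Hom:
  assumes i: "i \<in> {1..n}" and M: "\<And>i. i \<in> {1..n} \<Longrightarrow> lmodule (M i)"
  shows "(\<lambda>y. if y \<in> car (M i) then single i y else 0) \<in> Hom (M i) (dsum n M)"
  by (rule HomI)
    (use i in \<open>auto simp: car_dsum act_dsum single_def fun_eq_iff lmoduleD[OF M] act_zero_right[OF M]\<close>)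

lemma component_Hom:
  assumes i: "i \<in> {1..n}" and M: "\<And>i. i \<in> {1..n} \<Longrightarrow> lmodule (M i)"
  shows "(\<lambda>x. if x \<in> car (dsum n M) then x i else 0) \<in> Hom (dsum n M) (M i)"
  using lmoduleD[OF lmodule_dsum[of n M, OF M]] i
  by (intro HomI) (auto simp: car_dsum act_dsum)

lemma sum_fun_apply: "(\<Sum>i\<in>I. F i) x = (\<Sum>i\<in>I. F i x)"
  by (induction I rule: infinite_finite_induct) auto

lemma dsum_eq_sum_single:
  assumes "x \<in> car (dsum n M)"
  shows "x = (\<Sum>i\<in>{1..n}. single i (x i))"
proof
  fix j
  show "x j = (\<Sum>i\<in>{1..n}. single i (x i)) j"
    using assms by (auto simp: sum_fun_apply single_def car_dsum sum.delta')
qed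

section \<open>Homomorphisms from standard to costandard modules, and their coefficients\<close>

locale standard_costandard_pairing = quasi_hereditary_algebra scale n e Delta Nabla
  for scale :: "'k::alg_closed_field \<Rightarrow> 'a::ring_1 \<Rightarrow> 'a" and n :: nat and e :: "nat \<Rightarrow> 'a"
    and Delta :: "nat \<Rightarrow> ('a, 'd::ab_group_add) lmod"
    and Nabla :: "nat \<Rightarrow> ('a, 'c::ab_group_add) lmod" +
  fixes \<alpha> :: "nat \<Rightarrow> 'd \<Rightarrow> 'c"
  assumes alpha: "\<forall>i\<in>{1..n}. \<alpha> i \<in> Hom (Delta i) (Nabla i) \<and> \<alpha> i \<noteq> 0"
begin

lemma alpha_gen_nonzero:
  assumes "i \<in> {1..n}"
  shows "\<alpha> i (gen i) \<noteq> 0"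
  using alpha assms Hom_Delta_eq_zero[OF assms _ _ lmodule_Nabla[OF assms]] by blast

lemma alpha_Hom: "i \<in> {1..n} \<Longrightarrow> \<alpha> i \<in> Hom (Delta i) (Nabla i)"
  using alpha by blast

text \<open>For j < i the generator has a weight that \<nabla>(j) lacks. For i < j a functional in
  \<nabla>(j) is determined by the action of e_j A followed by evaluation at 1, and
  \<open>e j\<close> annihilates \<Delta>(i).\<close>

lemma Hom_Delta_Nabla_distinct:
  assumes i: "i \<in> {1..n}" and j: "j \<in> {1..n}" and "i \<noteq> j" and f: "f \<in> Hom (Delta i) (Nabla j)"
  shows "f = 0"
proof (rule Hom_Delta_eq_zero[OF i f _ lmodule_Nabla[OF j]])
  have fg: "f (gen i) \<in> car (Nabla j)" using HomD(1)[OF f gen_car[OF i]] .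
  consider "j < i" | "i < j" using \<open>i \<noteq> j\<close> by linarith
  then show "f (gen i) = 0"
  proof cases
    case 1
    then show ?thesis
      using idem_high_Nabla[OF j _ fg, of i] i HomD(4)[OF f gen_car[OF i], of "e i"]
        gen_fixed[OF i] by simp
  next
    case 2
    then have ji: "j \<in> {i<..n}" using j by simp
    obtain \<iota> where \<iota>: "\<iota> \<in> Hom (Nabla j) (costd j)" "bij_betw \<iota> (car (Nabla j)) (car (costd j))"
      using Nabla_iso[OF j] .
    have "\<iota> (f (gen i)) x = 0" for x
    proof -
      have "\<iota> (f (gen i)) x = \<iota> (f (gen i)) (e j * x)"
        using HomD(1)[OF \<iota>(1) fg] by (simp add: costd_iff[OF j])
      also have "\<dots> = act (costd j) (e j * x) (\<iota> (f (gen i))) 1" by (simp add: act_costd)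
      also have "\<dots> = \<iota> (f (act (Delta i) (e j * x) (gen i))) 1"
        using HomD(4)[OF \<iota>(1) fg] HomD(4)[OF f gen_car[OF i]] by simp
      also have "act (Delta i) (e j * x) (gen i) = 0"
        using idem_high_Delta[OF i ji lmodule_act[OF lmodule_Delta[OF i] gen_car[OF i]], of x]
        by (simp add: act_mult[OF lmodule_Delta[OF i] gen_car[OF i]])
      finally show ?thesis
        by (simp add: Hom_zero[OF f lmodule_Delta[OF i]] Hom_zero[OF \<iota>(1) lmodule_Nabla[OF j]])
    qed
    then have "\<iota> (f (gen i)) = \<iota> 0"
      by (simp add: fun_eq_iff Hom_zero[OF \<iota>(1) lmodule_Nabla[OF j]])
    then show ?thesis
      using \<iota>(2) fg lmodule_zero[OF lmodule_Nabla[OF j]] by (auto simp: bij_betw_def dest: inj_onD)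
  qed
qed

lemma Hom_Delta_Nabla_same:
  assumes i: "i \<in> {1..n}" and f: "f \<in> Hom (Delta i) (Nabla i)"
  obtains c where "\<And>x. x \<in> car (Delta i) \<Longrightarrow> f x = scalar scale (Nabla i) c (\<alpha> i x)"
proof -
  note N = lmodule_Nabla[OF i] and D = lmodule_Delta[OF i]
  obtain \<iota> where \<iota>: "\<iota> \<in> Hom (Nabla i) (costd i)" "bij_betw \<iota> (car (Nabla i)) (car (costd i))"
    using Nabla_iso[OF i] .
  \<comment> \<open>The vector e_i x applied to the generator has weight i, hence is a multiple c of
    the generator. As c does not depend on \<open>h\<close>, the value at 1 determines the whole
    functional, for \<open>f\<close> and \<alpha>_i alike.\<close>
  have "\<exists>c. \<forall>h\<in>Hom (Delta i) (Nabla i). \<iota> (h (gen i)) x = c * \<iota> (h (gen i)) 1" for x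
  proof -
    have car: "act (Delta i) (e i * x) (gen i) \<in> car (Delta i)"
      by (rule lmodule_act[OF D gen_car[OF i]])
    have "act (Delta i) (e i) (act (Delta i) (e i * x) (gen i)) = act (Delta i) (e i * x) (gen i)"
      by (simp add: idem_mult[OF i] flip: act_mult[OF D gen_car[OF i]])
    then obtain c where c: "act (Delta i) (e i * x) (gen i) = scalar scale (Delta i) c (gen i)"
      using weight_space_Delta[OF i car] by blast
    have "\<iota> (h (gen i)) x = c * \<iota> (h (gen i)) 1" if h: "h \<in> Hom (Delta i) (Nabla i)" for h
    proof -
      have hg: "h (gen i) \<in> car (Nabla i)" using HomD(1)[OF h gen_car[OF i]] .
      note L = HomD(1)[OF \<iota>(1) hg, unfolded costd_iff[OF i] linear_functional_iff]
      have "\<iota> (h (gen i)) x = act (costd i) (e i * x) (\<iota> (h (gen i))) 1"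
        using L by (simp add: act_costd)
      also have "\<dots> = \<iota> (h (act (Delta i) (e i * x) (gen i))) 1"
        using HomD(4)[OF \<iota>(1) hg] HomD(4)[OF h gen_car[OF i]] by simp
      also have "\<dots> = act (costd i) (scale c 1) (\<iota> (h (gen i))) 1"
        using HomD(4)[OF \<iota>(1) hg] HomD(4)[OF h gen_car[OF i]] by (simp add: c scalar_def)
      also have "\<dots> = c * \<iota> (h (gen i)) 1" using L by (simp add: act_costd)
      finally show ?thesis .
    qed
    then show ?thesis by blast
  qed
  then have "\<exists>c. \<forall>x. \<forall>h\<in>Hom (Delta i) (Nabla i). \<iota> (h (gen i)) x = c x * \<iota> (h (gen i)) 1"
    by (rule choice[OF allI])
  then obtain c where c: "\<And>x h. h \<in> Hom (Delta i) (Nabla i) \<Longrightarrow>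
      \<iota> (h (gen i)) x = c x * \<iota> (h (gen i)) 1"
    by blast
  have inj: "u = v" if "\<iota> u = \<iota> v" "u \<in> car (Nabla i)" "v \<in> car (Nabla i)" for u v
    using \<iota>(2) that by (auto simp: bij_betw_def dest: inj_onD)
  define v w where "v = f (gen i)" and "w = \<alpha> i (gen i)"
  have vw: "v \<in> car (Nabla i)" "w \<in> car (Nabla i)"
    using HomD(1)[OF f gen_car[OF i]] HomD(1)[OF alpha_Hom[OF i] gen_car[OF i]]
    by (simp_all add: v_def w_def)
  have "\<iota> w 1 \<noteq> 0"
  proof
    assume "\<iota> w 1 = 0"
    then have "\<iota> w x = 0" for x
      unfolding w_def by (subst c[OF alpha_Hom[OF i]]) simp
    then have "\<iota> w = \<iota> 0" by (simp add: fun_eq_iff Hom_zero[OF \<iota>(1) N])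
    then show False
      using inj[OF _ vw(2) lmodule_zero[OF N]] alpha_gen_nonzero[OF i] by (simp add: w_def)
  qed
  define d where "d = \<iota> v 1 / \<iota> w 1"
  have "\<iota> v = \<iota> (scalar scale (Nabla i) d w)"
  proof
    fix x
    note L = HomD(1)[OF \<iota>(1) vw(2), unfolded costd_iff[OF i] linear_functional_iff]
    have "\<iota> (scalar scale (Nabla i) d w) x = d * \<iota> w x"
      using HomD(4)[OF \<iota>(1) vw(2), of "scale d 1"] L by (simp add: scalar_def act_costd)
    also have "\<dots> = d * (c x * \<iota> w 1)" using c[OF alpha_Hom[OF i], of x] by (simp add: w_def)
    also have "\<dots> = c x * \<iota> v 1" using \<open>\<iota> w 1 \<noteq> 0\<close> by (simp add: d_def)
    also have "\<dots> = \<iota> v x" using c[OF f, of x] by (simp add: v_def)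
    finally show "\<iota> v x = \<iota> (scalar scale (Nabla i) d w) x" by simp
  qed
  then have vd: "v = scalar scale (Nabla i) d w"
    by (rule inj[OF _ vw(1) scalar_car[OF N vw(2)]])
  have "f x = scalar scale (Nabla i) d (\<alpha> i x)" if "x \<in> car (Delta i)" for x
  proof -
    obtain a where "x = act (Delta i) a (gen i)" using \<open>x \<in> _\<close> gen_generates[OF i] by blast
    then show ?thesis
      using HomD(4)[OF f gen_car[OF i], of a] HomD(4)[OF alpha_Hom[OF i] gen_car[OF i], of a]
        act_scalar[OF N vw(2), of a d] vd by (simp add: v_def w_def)
  qed
  then show thesis by (rule that)
qed

text \<open>The componentwise form of the expansion of \<open>h\<close> in the \<alpha>_j;
  \<open>sum_component_map\<close> matches it with the sum in \<open>pairing\<close>.\<close>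

definition has_coefficients ::
  "((nat \<Rightarrow> 'd) \<Rightarrow> nat \<Rightarrow> 'c) \<Rightarrow> (nat \<Rightarrow> 'k) \<Rightarrow> bool" where
  "has_coefficients h a \<longleftrightarrow> (\<forall>x\<in>car (dsum n Delta).
     h x = (\<lambda>j. if j \<in> {1..n} then scalar scale (Nabla j) (a j) (\<alpha> j (x j)) else 0))"

lemma sum_component_map:
  "(\<Sum>i\<in>{1..n}. scalar scale (dsum n Nabla) (a i) (component_map \<alpha> i x)) =
     (\<lambda>j. if j \<in> {1..n} then scalar scale (Nabla j) (a j) (\<alpha> j (x j)) else 0)"
proof
  fix j
  have "(\<Sum>i\<in>{1..n}. scalar scale (dsum n Nabla) (a i) (component_map \<alpha> i x)) j =
    (\<Sum>i\<in>{1..n}. if i = j then scalar scale (Nabla j) (a j) (\<alpha> j (x j)) else 0)"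
    unfolding sum_fun_apply
    by (rule sum.cong) (auto simp: scalar_def act_dsum component_map_def
        act_zero_right[OF lmodule_Nabla])
  then show "(\<Sum>i\<in>{1..n}. scalar scale (dsum n Nabla) (a i) (component_map \<alpha> i x)) j =
     (if j \<in> {1..n} then scalar scale (Nabla j) (a j) (\<alpha> j (x j)) else 0)"
    by simp
qed

lemmas lmodule_sums = lmodule_dsum[of n Delta, OF lmodule_Delta] lmodule_dsum[of n Nabla, OF lmodule_Nabla]

lemma single_gen_car: "i \<in> {1..n} \<Longrightarrow> single i (gen i) \<in> car (dsum n Delta)"
  by (simp add: car_dsum single_def gen_car lmodule_zero[OF lmodule_Delta])

lemma has_coefficients_gen:
  assumes a: "has_coefficients h a" and i: "i \<in> {1..n}"
  shows "h (single i (gen i)) i = scalar scale (Nabla i) (a i) (\<alpha> i (gen i))"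
  using a[unfolded has_coefficients_def, rule_format, OF single_gen_car[OF i]] i
  by (simp add: single_def)

text \<open>Evaluation at the generators isolates each coefficient, because \<alpha>_i is non-zero
  there. This makes the definite description in \<open>pairing\<close> meaningful.\<close>

lemma has_coefficients_unique:
  assumes a: "has_coefficients h a" and b: "has_coefficients h b" and i: "i \<in> {1..n}"
  shows "a i = b i"
proof -
  note N = lmodule_Nabla[OF i]
  let ?w = "\<alpha> i (gen i)"
  have w: "?w \<in> car (Nabla i)" using HomD(1)[OF alpha_Hom[OF i] gen_car[OF i]] .
  have "h (single i (gen i)) i = scalar scale (Nabla i) (a i) ?w"
    "h (single i (gen i)) i = scalar scale (Nabla i) (b i) ?w"
    by (rule has_coefficients_gen[OF _ i], fact)+
  then have "scalar scale (Nabla i) (a i - b i + b i) ?w = scalar scale (Nabla i) (b i) ?w" by simp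
  then have "scalar scale (Nabla i) (a i - b i) ?w = 0"
    unfolding scalar_add_left[OF N w] by simp
  from scalar_eq_zero[OF N w this alpha_gen_nonzero[OF i]] show ?thesis by simp
qed

text \<open>Written as a matrix of maps \<open>H i j\<close> from \<Delta>(i) to \<nabla>(j),
  \<open>h\<close> is diagonal, and each diagonal entry is a multiple of \<alpha>_i.\<close>

lemma ex_coefficients:
  assumes h: "h \<in> Hom (dsum n Delta) (dsum n Nabla)"
  shows "\<exists>a. has_coefficients h a"
proof -
  define H where "H i j = (\<lambda>x. if x \<in> car (dsum n Nabla) then x j else 0) \<circ> h \<circ>
    (\<lambda>y. if y \<in> car (Delta i) then single i y else 0)" for i j
  have H: "H i j \<in> Hom (Delta i) (Nabla j)" if "i \<in> {1..n}" "j \<in> {1..n}" for i j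
    unfolding H_def comp_assoc
    by (rule Hom_comp[OF Hom_comp[OF single_Hom[OF that(1) lmodule_Delta] h lmodule_sums(1)]
          component_Hom[OF that(2) lmodule_Nabla] lmodule_sums(2)])
  have Hval: "H i j y = h (single i y) j" if "y \<in> car (Delta i)" "i \<in> {1..n}" for i j y
    using that HomD(1)[OF h, of "single i y"]
    by (simp add: H_def car_dsum single_def lmodule_zero[OF lmodule_Delta])
  have "\<exists>c. \<forall>x\<in>car (Delta i). H i i x = scalar scale (Nabla i) c (\<alpha> i x)" if "i \<in> {1..n}" for i
    using Hom_Delta_Nabla_same[OF that H[OF that that]] by metis
  then obtain a where a: "\<And>i x. i \<in> {1..n} \<Longrightarrow> x \<in> car (Delta i) \<Longrightarrow>
      H i i x = scalar scale (Nabla i) (a i) (\<alpha> i x)"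
    by metis
  have "h x j = (if j \<in> {1..n} then scalar scale (Nabla j) (a j) (\<alpha> j (x j)) else 0)"
    if x: "x \<in> car (dsum n Delta)" for x j
  proof (cases "j \<in> {1..n}")
    case True
    have xi: "x i \<in> car (Delta i)" if "i \<in> {1..n}" for i using x that by (simp add: car_dsum)
    have s: "single i (x i) \<in> car (dsum n Delta)" if "i \<in> {1..n}" for i
      using xi[OF that] that by (auto simp: car_dsum single_def lmodule_zero[OF lmodule_Delta])
    have "h x = h (\<Sum>i\<in>{1..n}. single i (x i))" using dsum_eq_sum_single[OF x] by simp
    also have "\<dots> = (\<Sum>i\<in>{1..n}. h (single i (x i)))" by (rule Hom_sum[OF h lmodule_sums(1) s])
    finally have "h x j = (\<Sum>i\<in>{1..n}. H i j (x i))"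
      using xi by (simp add: sum_fun_apply Hval)
    also have "\<dots> = (\<Sum>i\<in>{1..n}. if i = j then H j j (x j) else 0)"
      by (rule sum.cong) (use Hom_Delta_Nabla_distinct[OF _ True _ H[OF _ True]] in auto)
    finally show ?thesis using True a[OF True xi[OF True]] by simp
  next
    case False
    then show ?thesis using HomD(1)[OF h x] by (auto simp: car_dsum)
  qed
  then show ?thesis unfolding has_coefficients_def by blast
qed

abbreviation pair :: "((nat \<Rightarrow> 'd) \<Rightarrow> 't) \<Rightarrow> ('t \<Rightarrow> nat \<Rightarrow> 'c) \<Rightarrow> 'k" where
  "pair \<equiv> pairing scale n Delta Nabla \<alpha>"

lemma pairing_eq:
  assumes "has_coefficients (g \<circ> f) a"
  shows "pair f g = (\<Sum>i\<in>{1..n}. a i)"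
  unfolding pairing_def sum_component_map has_coefficients_def[symmetric]
  proof (rule the_equality)
  show "\<exists>b. has_coefficients (g \<circ> f) b \<and> (\<Sum>i\<in>{1..n}. a i) = (\<Sum>i\<in>{1..n}. b i)"
    using assms by blast
  fix s assume "\<exists>b. has_coefficients (g \<circ> f) b \<and> s = (\<Sum>i\<in>{1..n}. b i)"
  then obtain b where b: "has_coefficients (g \<circ> f) b" "s = (\<Sum>i\<in>{1..n}. b i)" by blast
  show "s = (\<Sum>i\<in>{1..n}. a i)"
    unfolding b(2) by (rule sum.cong[OF refl has_coefficients_unique[OF b(1) assms]])
qed

lemma has_coefficients_add:
  assumes "has_coefficients h a" "has_coefficients h' a'"
    "\<And>x. x \<in> car (dsum n Delta) \<Longrightarrow> h'' x = h x + h' x"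
  shows "has_coefficients h'' (\<lambda>i. a i + a' i)"
  unfolding has_coefficients_def
proof
  fix x assume x: "x \<in> car (dsum n Delta)"
  have "\<alpha> j (x j) \<in> car (Nabla j)" if "j \<in> {1..n}" for j
    using x that HomD(1)[OF alpha_Hom[OF that]] by (simp add: car_dsum)
  then show "h'' x = (\<lambda>j. if j \<in> {1..n} then scalar scale (Nabla j) (a j + a' j) (\<alpha> j (x j)) else 0)"
    using assms x by (auto simp: has_coefficients_def fun_eq_iff scalar_add_left[OF lmodule_Nabla])
qed

lemma has_coefficients_scale:
  assumes "has_coefficients h a"
    "\<And>x. x \<in> car (dsum n Delta) \<Longrightarrow> h' x = scalar scale (dsum n Nabla) c (h x)"
  shows "has_coefficients h' (\<lambda>i. c * a i)"
  unfolding has_coefficients_def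
proof
  fix x assume x: "x \<in> car (dsum n Delta)"
  have "\<alpha> j (x j) \<in> car (Nabla j)" if "j \<in> {1..n}" for j
    using x that HomD(1)[OF alpha_Hom[OF that]] by (simp add: car_dsum)
  then show "h' x = (\<lambda>j. if j \<in> {1..n} then scalar scale (Nabla j) (c * a j) (\<alpha> j (x j)) else 0)"
    using assms x
    by (auto simp: has_coefficients_def fun_eq_iff scalar_mult[OF lmodule_Nabla])
      (auto simp: scalar_def act_dsum)
qed

lemma
  assumes f: "f \<in> Hom (dsum n Delta) M" and g: "g \<in> Hom M (dsum n Nabla)" and M: "lmodule M"
  shows pairing_add_left: "f' \<in> Hom (dsum n Delta) M \<Longrightarrow> pair (f + f') g = pair f g + pair f' g"
    and pairing_scale_left: "pair (hom_scale scale M c f) g = c * pair f g"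
    and pairing_add_right: "g' \<in> Hom M (dsum n Nabla) \<Longrightarrow> pair f (g + g') = pair f g + pair f g'"
    and pairing_scale_right: "pair f (hom_scale scale (dsum n Nabla) c g) = c * pair f g"
proof -
  obtain a where a: "has_coefficients (g \<circ> f) a" using ex_coefficients[OF Hom_comp[OF f g M]] by blast
  show "pair (f + f') g = pair f g + pair f' g" if f': "f' \<in> Hom (dsum n Delta) M"
  proof -
    obtain b where b: "has_coefficients (g \<circ> f') b"
      using ex_coefficients[OF Hom_comp[OF f' g M]] by blast
    have "has_coefficients (g \<circ> (f + f')) (\<lambda>i. a i + b i)"
      by (rule has_coefficients_add[OF a b]) (simp add: HomD[OF f] HomD[OF f'] HomD[OF g])
    then show ?thesis using a b by (simp add: pairing_eq sum.distrib)
  qed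
  show "pair f (g + g') = pair f g + pair f g'" if g': "g' \<in> Hom M (dsum n Nabla)"
  proof -
    obtain b where b: "has_coefficients (g' \<circ> f) b"
      using ex_coefficients[OF Hom_comp[OF f g' M]] by blast
    have "has_coefficients ((g + g') \<circ> f) (\<lambda>i. a i + b i)"
      by (rule has_coefficients_add[OF a b]) simp
    then show ?thesis using a b by (simp add: pairing_eq sum.distrib)
  qed
  have "has_coefficients (g \<circ> hom_scale scale M c f) (\<lambda>i. c * a i)"
    by (rule has_coefficients_scale[OF a]) (simp add: hom_scale_def Hom_scalar[OF g] HomD[OF f])
  then show "pair (hom_scale scale M c f) g = c * pair f g"
    using a by (simp add: pairing_eq sum_distrib_left)
  have "has_coefficients (hom_scale scale (dsum n Nabla) c g \<circ> f) (\<lambda>i. c * a i)"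
    by (rule has_coefficients_scale[OF a]) (simp add: hom_scale_def)
  then show "pair f (hom_scale scale (dsum n Nabla) c g) = c * pair f g"
    using a by (simp add: pairing_eq sum_distrib_left)
qed

lemma pairing_zero_right: "f \<in> Hom (dsum n Delta) M \<Longrightarrow> pair f 0 = 0"
  using pairing_eq[of 0 f "\<lambda>_. 0"]
  by (simp add: has_coefficients_def fun_eq_iff car_dsum scalar_zero[OF lmodule_Nabla]
      HomD(1)[OF alpha_Hom])

text \<open>At the generator of the i-th summand, the i-th component of the composite is a_i times
  the non-zero vector \<alpha>_i(gen i). Restricting to that summand and projecting reduces its
  vanishing to \<open>composite_eq_zero\<close>.\<close>

lemma pairing_factors_eq_zero:
  assumes M: "tilting n Delta Nabla M" and N: "tilting n Delta Nabla N"
    and \<phi>: "\<phi> \<in> Hom M N"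
    and minimal: "\<not> (\<exists>X X' Y Y'. decomposes M X X' \<and> decomposes N Y Y' \<and> X \<noteq> {0} \<and>
      bij_betw (\<lambda>x. projection Y Y' (\<phi> x)) X Y)"
    and f: "f \<in> Hom (dsum n Delta) M" and \<sigma>: "\<sigma> \<in> Hom N (dsum n Nabla)"
  shows "pair f (\<sigma> \<circ> \<phi>) = 0"
proof -
  have lm: "lmodule M" "lmodule N" using M N by (auto simp: tilting_def)
  obtain a where a: "has_coefficients (\<sigma> \<circ> \<phi> \<circ> f) a"
    using ex_coefficients[OF Hom_comp[OF f Hom_comp[OF \<phi> \<sigma> lm(2)] lm(1)]] by blast
  have "a i = 0" if i: "i \<in> {1..n}" for i
  proof -
    let ?f = "f \<circ> (\<lambda>y. if y \<in> car (Delta i) then single i y else 0)"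
    let ?\<sigma> = "(\<lambda>x. if x \<in> car (dsum n Nabla) then x i else 0) \<circ> \<sigma>"
    have fH: "?f \<in> Hom (Delta i) M"
      by (rule Hom_comp[OF single_Hom[OF i lmodule_Delta] f lmodule_sums(1)])
    have \<sigma>H: "?\<sigma> \<in> Hom N (Nabla i)"
      by (rule Hom_comp[OF \<sigma> component_Hom[OF i lmodule_Nabla] lmodule_sums(2)])
    have "?\<sigma> (\<phi> (?f (gen i))) = 0"
      by (rule composite_eq_zero[OF i M N \<phi> minimal fH \<sigma>H])
    then have "\<sigma> (\<phi> (f (single i (gen i)))) i = 0"
      using gen_car[OF i] Hom_in_car[OF \<sigma> lmodule_sums(2)] by simp
    moreover have "\<sigma> (\<phi> (f (single i (gen i)))) i = scalar scale (Nabla i) (a i) (\<alpha> i (gen i))"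
      using has_coefficients_gen[OF a i] by simp
    ultimately show ?thesis
      using scalar_eq_zero[OF lmodule_Nabla[OF i] HomD(1)[OF alpha_Hom[OF i] gen_car[OF i]] _
          alpha_gen_nonzero[OF i]] by simp
  qed
  then show ?thesis using pairing_eq[OF a] by simp
qed

end

subsection \<open>Homotopy classes\<close>

lemma lmodule_zero_lmod: "lmodule zero_lmod"
  by (simp add: lmodule_def zero_lmod_def)

lemma shift_stalk:
  assumes "lmodule M"
  shows "lmodule (obj (shift (stalk M) p) m)" "bdry (shift (stalk M) p) m = (\<lambda>_. 0)"
    "obj (shift (stalk M) p) (- p) = M"
  using assms lmodule_zero_lmod by (auto simp: shift_def stalk_def)

context fd_algebra
begin

context
  fixes C :: "('a, 'm::ab_group_add) cpx" and D :: "('a, 'n::ab_group_add) cpx"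
  assumes obj: "\<And>m. lmodule (obj D m)" and bdry: "\<And>m. bdry D m = (\<lambda>_. 0)"
begin

lemma Hom_Com_iff:
  "g \<in> Hom_Com C D \<longleftrightarrow> (\<forall>m. g m \<in> Hom (obj C m) (obj D m)) \<and> (\<forall>m x. g (m + 1) (bdry C m x) = 0)"
  by (auto simp: Hom_Com_def bdry fun_eq_iff)

text \<open>With zero differential on the target only one homotopy term survives, so every component
  of a null-homotopic map factors through the differential of the source.\<close>

lemma null_homotopic_iff:
  "null_homotopic C D g \<longleftrightarrow> (\<exists>s. (\<forall>m. s m \<in> Hom (obj C m) (obj D (m - 1))) \<and>
     (\<forall>m x. g m x = s (m + 1) (bdry C m x)))"
  by (simp add: null_homotopic_def bdry)

lemma Hom_Com_car: "g \<in> Hom_Com C D \<Longrightarrow> g m x \<in> car (obj D m)"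
  by (auto simp: Hom_Com_iff intro: Hom_in_car[OF _ obj])

lemma
  assumes g: "g \<in> Hom_Com C D"
  shows Hom_Com_add: "h \<in> Hom_Com C D \<Longrightarrow> g + h \<in> Hom_Com C D"
    and Hom_Com_diff: "h \<in> Hom_Com C D \<Longrightarrow> g - h \<in> Hom_Com C D"
    and Hom_Com_scale: "com_scale scale D c g \<in> Hom_Com C D"
proof -
  show add: "g + h \<in> Hom_Com C D" if "h \<in> Hom_Com C D" for h
    using g that unfolding Hom_Com_iff by (simp add: Hom_plus[OF _ _ obj])
  show "g - h \<in> Hom_Com C D" if h: "h \<in> Hom_Com C D" for h
  proof -
    have "- h \<in> Hom_Com C D" using h unfolding Hom_Com_iff by (simp add: Hom_uminus[OF _ obj])
    from add[OF this] show ?thesis by simp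
  qed
  show "com_scale scale D c g \<in> Hom_Com C D"
    using g unfolding Hom_Com_iff
    by (simp add: com_scale_def Hom_hom_scale[OF _ obj])
      (simp add: hom_scale_def scalar_def act_zero_right[OF obj])
qed

lemma null_homotopic_add:
  assumes "null_homotopic C D g" "null_homotopic C D h"
  shows "null_homotopic C D (g + h)"
proof -
  obtain s t where "\<forall>m. s m \<in> Hom (obj C m) (obj D (m - 1))" "\<forall>m x. g m x = s (m + 1) (bdry C m x)"
    "\<forall>m. t m \<in> Hom (obj C m) (obj D (m - 1))" "\<forall>m x. h m x = t (m + 1) (bdry C m x)"
    using assms unfolding null_homotopic_iff by blast
  then show ?thesis
    unfolding null_homotopic_iff
    by (intro exI[of _ "s + t"]) (simp add: Hom_plus[OF _ _ obj])
qed

lemma null_homotopic_uminus: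
  assumes "null_homotopic C D g"
  shows "null_homotopic C D (- g)"
proof -
  obtain s where "\<forall>m. s m \<in> Hom (obj C m) (obj D (m - 1))" "\<forall>m x. g m x = s (m + 1) (bdry C m x)"
    using assms unfolding null_homotopic_iff by blast
  then show ?thesis
    unfolding null_homotopic_iff
    by (intro exI[of _ "- s"]) (simp add: Hom_uminus[OF _ obj])
qed

lemma null_homotopic_scale:
  assumes "null_homotopic C D g"
  shows "null_homotopic C D (com_scale scale D c g)"
proof -
  obtain s where s: "\<forall>m. s m \<in> Hom (obj C m) (obj D (m - 1))" "\<forall>m x. g m x = s (m + 1) (bdry C m x)"
    using assms unfolding null_homotopic_iff by blast
  then show ?thesis
    unfolding null_homotopic_iff
    by (intro exI[of _ "\<lambda>m. hom_scale scale (obj D (m - 1)) c (s m)"])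
      (simp add: com_scale_def Hom_hom_scale[OF _ obj], simp add: hom_scale_def)
qed

lemma null_homotopic_zero: "null_homotopic C D 0"
  unfolding null_homotopic_iff
  by (intro exI[of _ 0]) (auto intro!: HomI simp: lmoduleD[OF obj] act_zero_right[OF obj])

lemma mem_homotopy_class: "g \<in> Hom_Com C D \<Longrightarrow> g \<in> homotopy_class C D g"
  using null_homotopic_zero by (simp add: homotopy_class_def)

lemma homotopy_class_eq:
  assumes "null_homotopic C D (g - h)"
  shows "homotopy_class C D g = homotopy_class C D h"
proof -
  have "null_homotopic C D (u - h)" if "null_homotopic C D (u - g)" for u
    using null_homotopic_add[OF that assms] by simp
  moreover have "null_homotopic C D (u - g)" if "null_homotopic C D (u - h)" for u
    using null_homotopic_add[OF that null_homotopic_uminus[OF assms]] by simp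
  ultimately show ?thesis unfolding homotopy_class_def by blast
qed

text \<open>The union in \<open>Ext_add\<close> runs over representatives that all give the same
  class, and it is not empty because a morphism represents its own class.\<close>

lemma Ext_add_homotopy_class:
  assumes "g \<in> Hom_Com C D" "h \<in> Hom_Com C D"
  shows "Ext_add C D (homotopy_class C D g) (homotopy_class C D h) = homotopy_class C D (g + h)"
proof -
  have "homotopy_class C D (g' + h') = homotopy_class C D (g + h)"
    if "g' \<in> homotopy_class C D g" "h' \<in> homotopy_class C D h" for g' h'
  proof (rule homotopy_class_eq)
    have "null_homotopic C D ((g' - g) + (h' - h))"
      using that by (intro null_homotopic_add) (auto simp: homotopy_class_def)
    then show "null_homotopic C D (g' + h' - (g + h))" by (simp add: algebra_simps)
  qed
  then show ?thesis
    unfolding Ext_add_def using mem_homotopy_class[OF assms(1)] mem_homotopy_class[OF assms(2)]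
    by blast
qed

lemma Ext_scale_homotopy_class:
  assumes "g \<in> Hom_Com C D"
  shows "Ext_scale scale C D c (homotopy_class C D g) = homotopy_class C D (com_scale scale D c g)"
proof -
  have "homotopy_class C D (com_scale scale D c g') = homotopy_class C D (com_scale scale D c g)"
    if g': "g' \<in> homotopy_class C D g" for g'
  proof (rule homotopy_class_eq)
    have "com_scale scale D c (g' - g) = com_scale scale D c g' - com_scale scale D c g"
      using g' Hom_Com_car[OF assms] Hom_Com_car[of g']
      by (simp add: com_scale_def hom_scale_def scalar_def fun_eq_iff homotopy_class_def
          act_diff_right[OF obj])
    then show "null_homotopic C D (com_scale scale D c g' - com_scale scale D c g)"
      using null_homotopic_scale[of "g' - g" c] g' by (simp add: homotopy_class_def)
  qed
  then show ?thesis
    unfolding Ext_scale_def using mem_homotopy_class[OF assms] by blast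
qed

end

end

theorem theorem4:
  fixes scale :: "'k::alg_closed_field \<Rightarrow> 'a::ring_1 \<Rightarrow> 'a"
    and n :: nat and e :: "nat \<Rightarrow> 'a"
    and Delta :: "nat \<Rightarrow> ('a, 'd::ab_group_add) lmod"
    and Nabla :: "nat \<Rightarrow> ('a, 'c::ab_group_add) lmod"
    and k l :: nat
    and T :: "nat \<Rightarrow> ('a, 't::ab_group_add) lmod"
    and \<phi> :: "nat \<Rightarrow> 't \<Rightarrow> 't" and \<epsilon> :: "'t \<Rightarrow> nat \<Rightarrow> 'c"
    and \<alpha> :: "nat \<Rightarrow> 'd \<Rightarrow> 'c"
  defines "\<D> \<equiv> dsum n Delta" and "\<N> \<equiv> dsum n Nabla"
    and "\<T> \<equiv> tilting_complex k T \<phi>" and "\<N>l \<equiv> shift (stalk (dsum n Nabla)) (int l)"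
  assumes "fd_algebra scale"
    and "basic_algebra n e"
    and "\<forall>i\<in>{1..n}. standard_module n e i (Delta i)"
    and "\<forall>i\<in>{1..n}. costandard_module scale n e i (Nabla i)"
    and "quasi_hereditary scale n e Delta"
    and "tilting_resolution n Delta Nabla \<N> k T \<phi> \<epsilon>"
    and "minimal_complex k T \<phi>"
    and "l \<le> k"
    and "\<forall>i\<in>{1..n}. \<alpha> i \<in> Hom (Delta i) (Nabla i) \<and> \<alpha> i \<noteq> 0"
  shows "(\<forall>f\<in>Hom \<D> (T l). \<forall>g\<in>Hom_Com \<T> \<N>l.
            null_homotopic \<T> \<N>l g \<longrightarrow> pairing scale n Delta Nabla \<alpha> f (g (- int l)) = 0) \<and>
         (\<exists>B. bilinear_on (Hom \<D> (T l)) (+) (hom_scale scale (T l))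
                 (Ext_space \<T> \<N>l) (Ext_add \<T> \<N>l) (Ext_scale scale \<T> \<N>l) B \<and>
              (\<forall>f\<in>Hom \<D> (T l). \<forall>g\<in>Hom_Com \<T> \<N>l.
                 B f (homotopy_class \<T> \<N>l g) = pairing scale n Delta Nabla \<alpha> f (g (- int l))))"
proof -
  interpret fd_algebra scale by fact
  interpret standard_costandard_pairing scale n e Delta Nabla \<alpha>
    by unfold_locales fact+
  note res = \<open>tilting_resolution n Delta Nabla \<N> k T \<phi> \<epsilon>\<close>[unfolded tilting_resolution_def]
  have lN: "lmodule (dsum n Nabla)" by (rule lmodule_sums(2))
  have oD: "\<And>m. lmodule (obj \<N>l m)" and bD: "\<And>m. bdry \<N>l m = (\<lambda>_. 0)"
    and objl: "obj \<N>l (- int l) = dsum n Nabla"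
    unfolding \<N>l_def by (rule shift_stalk[OF lN])+
  note ops = Hom_Com_add[OF oD bD] Hom_Com_diff[OF oD bD] Hom_Com_scale[OF oD bD]
  have tilt: "tilting n Delta Nabla (T j)" if "j \<le> k" for j using res that by blast
  have lT: "lmodule (T l)" using tilt[OF \<open>l \<le> k\<close>] by (simp add: tilting_def)
  have objT: "obj \<T> (- int j) = T j" if "j \<le> k" for j
    using that by (simp add: \<T>_def tilting_complex_def)
  have comp: "g (- int l) \<in> Hom (T l) (dsum n Nabla)" if "g \<in> Hom_Com \<T> \<N>l" for g
  proof -
    have "g (- int l) \<in> Hom (obj \<T> (- int l)) (obj \<N>l (- int l))"
      using that by (simp add: Hom_Com_def)
    then show ?thesis by (simp only: objl objT[OF \<open>l \<le> k\<close>])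
  qed
  have null: "pair f (g (- int l)) = 0"
    if f: "f \<in> Hom \<D> (T l)" and g: "null_homotopic \<T> \<N>l g" for f g
  proof -
    obtain s where s: "\<And>m. s m \<in> Hom (obj \<T> m) (obj \<N>l (m - 1))"
      "\<And>m x. g m x = s (m + 1) (bdry \<T> m x)"
      using g unfolding null_homotopic_iff[OF oD bD] by blast
    have fD: "f \<in> Hom (dsum n Delta) (T l)" using f by (simp add: \<D>_def)
    show ?thesis
    proof (cases l)
      \<comment> \<open>The differential leaving T_0 is zero, so the component of \<open>g\<close>
        in position 0 is constantly s_1(0) = 0.\<close>
      case 0
      have "obj \<T> 1 = zero_lmod" by (simp add: \<T>_def tilting_complex_def)
      then have "s 1 0 = 0" using Hom_zero[OF s(1)[of 1]] lmodule_zero_lmod by simp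
      then have "g (- int l) = 0"
        using s(2)[of 0] 0 by (simp add: fun_eq_iff \<T>_def tilting_complex_def)
      then show ?thesis using pairing_zero_right[OF fD] by simp
    next
      case (Suc j)
      \<comment> \<open>The homotopy component after \<phi>_l sits in position -l + 1, where the
        complex has T_(l-1).\<close>
      have l1: "- int l + 1 = - int j" using Suc by simp
      have jk: "j \<le> k" using Suc \<open>l \<le> k\<close> by simp
      have "s (- int l + 1) \<in> Hom (obj \<T> (- int l + 1)) (obj \<N>l (- int l))"
        using s(1)[of "- int l + 1"] by simp
      then have \<sigma>: "s (- int j) \<in> Hom (T j) (dsum n Nabla)"
        by (simp only: l1 objl objT[OF jk])
      have "bdry \<T> (- int l) = \<phi> l"
        using Suc \<open>l \<le> k\<close> by (simp add: \<T>_def tilting_complex_def nat_add_distrib)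
      then have "g (- int l) = s (- int j) \<circ> \<phi> l"
        unfolding fun_eq_iff comp_apply using s(2)[of "- int l"] l1 by simp
      moreover have "pair f (s (- int j) \<circ> \<phi> l) = 0"
      proof (rule pairing_factors_eq_zero[OF tilt[OF \<open>l \<le> k\<close>] tilt[OF jk] _ _ fD \<sigma>])
        have "\<forall>l\<in>{1..k}. \<phi> l \<in> Hom (T l) (T (l - 1))" using res by blast
        from this[rule_format, of l] show "\<phi> l \<in> Hom (T l) (T j)" using Suc \<open>l \<le> k\<close> by simp
        show "\<not> (\<exists>X X' Y Y'. decomposes (T l) X X' \<and> decomposes (T j) Y Y' \<and> X \<noteq> {0} \<and>
            bij_betw (\<lambda>x. projection Y Y' (\<phi> l x)) X Y)"
          using \<open>minimal_complex k T \<phi>\<close>[unfolded minimal_complex_def, rule_format, of l]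
            Suc \<open>l \<le> k\<close> by simp
      qed
      ultimately show ?thesis by simp
    qed
  qed
  \<comment> \<open>An arbitrary representative of the class is chosen; the vanishing on
    null-homotopic maps shows that the choice does not affect the value.\<close>
  define B where "B f X = pair f ((SOME g. g \<in> X) (- int l))"
    for f :: "(nat \<Rightarrow> 'd) \<Rightarrow> 't" and X :: "(int \<Rightarrow> 't \<Rightarrow> nat \<Rightarrow> 'c) set"
  have B: "B f (homotopy_class \<T> \<N>l g) = pair f (g (- int l))"
    if f: "f \<in> Hom \<D> (T l)" and g: "g \<in> Hom_Com \<T> \<N>l" for f g
  proof -
    define g' where "g' = (SOME g'. g' \<in> homotopy_class \<T> \<N>l g)"
    have "g' \<in> homotopy_class \<T> \<N>l g"
      unfolding g'_def using mem_homotopy_class[OF oD bD g]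
      by (rule someI[of "\<lambda>h. h \<in> homotopy_class \<T> \<N>l g"])
    then have g': "g' \<in> Hom_Com \<T> \<N>l" "null_homotopic \<T> \<N>l (g' - g)"
      by (auto simp: homotopy_class_def)
    have fD: "f \<in> Hom (dsum n Delta) (T l)" using f by (simp add: \<D>_def)
    have "pair f ((g' - g) (- int l) + g (- int l)) = pair f ((g' - g) (- int l)) + pair f (g (- int l))"
      by (rule pairing_add_right[OF fD comp[OF ops(2)[OF g'(1) g]] lT comp[OF g]])
    then show ?thesis using null[OF f g'(2)] by (simp add: B_def g'_def)
  qed
  have "bilinear_on (Hom \<D> (T l)) (+) (hom_scale scale (T l))
      (Ext_space \<T> \<N>l) (Ext_add \<T> \<N>l) (Ext_scale scale \<T> \<N>l) B"
    \<comment> \<open>The extension space is an image, so quantifiers over it become quantifiers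
      over morphisms of complexes, and each law reduces to one for \<open>pair\<close>.\<close>
    unfolding bilinear_on_def Ext_space_def ball_simps
  proof (intro conjI ballI allI)
    fix f g c assume f: "f \<in> Hom \<D> (T l)" and g: "g \<in> Hom_Com \<T> \<N>l"
    have fD: "f \<in> Hom (dsum n Delta) (T l)" using f by (simp add: \<D>_def)
    show "B (f + f') (homotopy_class \<T> \<N>l g) =
        B f (homotopy_class \<T> \<N>l g) + B f' (homotopy_class \<T> \<N>l g)" if f': "f' \<in> Hom \<D> (T l)" for f'
      using pairing_add_left[OF fD comp[OF g] lT, of f'] f' B[OF f g] B[OF f' g]
        B[OF Hom_plus[OF f f' lT] g] by (simp add: \<D>_def)
    show "B (hom_scale scale (T l) c f) (homotopy_class \<T> \<N>l g) = c * B f (homotopy_class \<T> \<N>l g)"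
      using pairing_scale_left[OF fD comp[OF g] lT, of c] B[OF f g] B[OF Hom_hom_scale[OF f lT] g]
      by simp
    show "B f (Ext_add \<T> \<N>l (homotopy_class \<T> \<N>l g) (homotopy_class \<T> \<N>l h)) =
        B f (homotopy_class \<T> \<N>l g) + B f (homotopy_class \<T> \<N>l h)" if h: "h \<in> Hom_Com \<T> \<N>l" for h
      using pairing_add_right[OF fD comp[OF g] lT comp[OF h]] B[OF f g] B[OF f h]
        B[OF f ops(1)[OF g h]] Ext_add_homotopy_class[OF oD bD g h] by simp
    show "B f (Ext_scale scale \<T> \<N>l c (homotopy_class \<T> \<N>l g)) = c * B f (homotopy_class \<T> \<N>l g)"
      using pairing_scale_right[OF fD comp[OF g] lT, of c] B[OF f g] B[OF f ops(3)[OF g]]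
        Ext_scale_homotopy_class[OF oD bD g] by (simp add: com_scale_def objl)
  qed
  then show ?thesis using null B by blast
qed

end
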